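(* For every finite field $\mathbb F_q$, there is an $\mathbb F_q$-representable matroid whose Kazhdan--Lusztig polynomial is not unimodal. Consequently, Kazhdan--Lusztig polynomials of matroids need not be log-concave or real-rooted: there exist matroids whose Kazhdan--Lusztig polynomial does not have a log-concave coefficient sequence, and there exist matroids whose Kazhdan--Lusztig polynomial does not have all its zeros real.
   Context: Kazhdan--Lusztig polynomials. For a (finite) loopless matroid $M$, $L(M)$ is its lattice of flats, $\operatorname{rk}_M$ its rank function, and $M/F$ is the contraction by a flat $F$. The Kazhdan--Lusztig polynomials $P_M(t)\in\mathbb Z[t]$ are the unique family, indexed by loopless matroids $M$, such that: (i) $P_M(t)=1$ if $\operatorname{rk} M=0$; (ii) $\deg P_M(t)<\operatorname{rk} M/2$ if $\operatorname{rk} M>0$; (iii) for every $M$ the polynomial $Z_M(t)=\sum_{F\in L(M)}t^{\operatorname{rk}_M(F)}P_{M/F}(t)$ is palindromic of degree $\operatorname{rk} M$, i.e. $t^{\operatorname{rk} M}Z_M(t^{-1})=Z_M(t)$. All matroids here are loopless. A finite sequence is unimodal if it weakly increases up to some index and then weakly decreases; a polynomial is unimodal if its coefficient sequence is. A sequence $(a_i)$ is log-concave if $a_i^2\ge a_{i-1}a_{i+1}$ for all interior indices $i$. *)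

theory Defs
  imports
    Complex_Main
    "HOL-Library.Function_Algebras"
    "HOL-Computational_Algebra.Polynomial"
begin

record 'a pre_matroid =
  ground :: "'a set"
  indep :: "'a set set"

locale matroid =
  fixes M :: "'a pre_matroid"
  assumes finite_ground: "finite (ground M)"
    and indep_subset_ground: "I \<in> indep M \<Longrightarrow> I \<subseteq> ground M"
    and indep_empty: "{} \<in> indep M"
    and indep_mono: "I \<in> indep M \<Longrightarrow> J \<subseteq> I \<Longrightarrow> J \<in> indep M"
    and indep_augment: "I \<in> indep M \<Longrightarrow> J \<in> indep M \<Longrightarrow> card I < card J
          \<Longrightarrow> \<exists>x\<in>J - I. insert x I \<in> indep M"

definition rank_of :: "'a pre_matroid \<Rightarrow> 'a set \<Rightarrow> nat" where
  "rank_of M X = Max (card ` {I \<in> indep M. I \<subseteq> X})"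

abbreviation rk :: "'a pre_matroid \<Rightarrow> nat" where
  "rk M \<equiv> rank_of M (ground M)"

definition flats :: "'a pre_matroid \<Rightarrow> 'a set set" where
  "flats M = {F. F \<subseteq> ground M \<and> (\<forall>x\<in>ground M - F. rank_of M F < rank_of M (insert x F))}"

text \<open>
  The rank function of the contraction is \<open>X \<mapsto> rank_of M (X \<union> F) - rank_of M F\<close>
  (\<open>rank_contract\<close> below); a set is independent if its rank is its size.
\<close>

definition contract :: "'a pre_matroid \<Rightarrow> 'a set \<Rightarrow> 'a pre_matroid" where
  "contract M F = \<lparr>ground = ground M - F,
     indep = {I. I \<subseteq> ground M - F \<and> rank_of M (I \<union> F) = card I + rank_of M F}\<rparr>"

definition loopless :: "'a pre_matroid \<Rightarrow> bool" where
  "loopless M \<longleftrightarrow> (\<forall>x\<in>ground M. {x} \<in> indep M)"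

definition fun_scale :: "'f::field \<Rightarrow> (nat \<Rightarrow> 'f) \<Rightarrow> nat \<Rightarrow> 'f" where
  "fun_scale c v = (\<lambda>i. c * v i)"

global_interpretation fun_vec: vector_space fun_scale
  by unfold_locales (auto simp: fun_scale_def fun_eq_iff algebra_simps)

text \<open>
  The vectors of the representation live in \<open>F\<^sup>n\<close>, rendered as the functions
  \<open>nat \<Rightarrow> F\<close> that vanish from index \<open>n\<close> on. Injectivity on \<open>I\<close> is required
  because linear independence of \<open>v ` I\<close> as a set does not see repeated vectors (parallel
  elements).
\<close>

definition representable_over :: "'f::field itself \<Rightarrow> 'a pre_matroid \<Rightarrow> bool" where
  "representable_over _ M \<longleftrightarrow>
     (\<exists>(n::nat) (v :: 'a \<Rightarrow> nat \<Rightarrow> 'f).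
        (\<forall>x\<in>ground M. \<forall>i\<ge>n. v x i = 0) \<and>
        (\<forall>I\<subseteq>ground M. I \<in> indep M \<longleftrightarrow> inj_on v I \<and> fun_vec.independent (v ` I)))"

definition Z_poly :: "('a pre_matroid \<Rightarrow> int poly) \<Rightarrow> 'a pre_matroid \<Rightarrow> int poly" where
  "Z_poly P M = (\<Sum>F\<in>flats M. monom 1 (rank_of M F) * P (contract M F))"

text \<open>
  Recall that \<open>reflect_poly p\<close> is \<open>t ^ degree p * p (1 / t)\<close>. Contraction stays inside the
  type \<open>'a pre_matroid\<close>, so a family may be indexed by the matroids on subsets of a
  fixed type.
\<close>

definition kl_family :: "('a pre_matroid \<Rightarrow> int poly) \<Rightarrow> bool" where
  "kl_family P \<longleftrightarrow> (\<forall>M. matroid M \<longrightarrow> loopless M \<longrightarrow>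
     (rk M = 0 \<longrightarrow> P M = 1) \<and>
     (rk M > 0 \<longrightarrow> 2 * degree (P M) < rk M) \<and>
     degree (Z_poly P M) = rk M \<and> reflect_poly (Z_poly P M) = Z_poly P M)"

text \<open>
  A family is arbitrary outside the loopless matroids, so it is the value at \<open>M\<close>, not
  the family itself, that is unique; see \<open>kl_family_exists\<close> and \<open>kl_family_unique\<close>
  below.
\<close>

definition kl_poly :: "'a pre_matroid \<Rightarrow> int poly" where
  "kl_poly M = (THE p. \<exists>P. kl_family P \<and> p = P M)"

definition unimodal :: "'a::linorder list \<Rightarrow> bool" where
  "unimodal xs \<longleftrightarrow> xs = [] \<or> (\<exists>k<length xs.
     (\<forall>i j. i \<le> j \<and> j \<le> k \<longrightarrow> xs ! i \<le> xs ! j) \<and>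
     (\<forall>i j. k \<le> i \<and> i \<le> j \<and> j < length xs \<longrightarrow> xs ! j \<le> xs ! i))"

definition log_concave_seq :: "'a::linordered_idom list \<Rightarrow> bool" where
  "log_concave_seq xs \<longleftrightarrow>
     (\<forall>i. 0 < i \<and> i + 1 < length xs \<longrightarrow> xs ! (i - 1) * xs ! (i + 1) \<le> (xs ! i)\<^sup>2)"

definition all_zeros_real :: "int poly \<Rightarrow> bool" where
  "all_zeros_real p \<longleftrightarrow> (\<forall>z::complex. poly (map_poly of_int p) z = 0 \<longrightarrow> z \<in> \<real>)"

context matroid
begin

lemma finite_indep: "finite (indep M)"
  by (rule finite_subset[of _ "Pow (ground M)"]) (auto simp: finite_ground dest: indep_subset_ground)

lemma finite_of_indep: "I \<in> indep M \<Longrightarrow> finite I"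
  using finite_ground finite_subset indep_subset_ground by blast

lemma card_le_rank: "I \<in> indep M \<Longrightarrow> I \<subseteq> X \<Longrightarrow> card I \<le> rank_of M X"
  unfolding rank_of_def by (rule Max_ge) (auto simp: finite_indep)

lemma obtain_basis:
  obtains B where "B \<in> indep M" "B \<subseteq> X" "card B = rank_of M X"
proof -
  have "Max (card ` {I \<in> indep M. I \<subseteq> X}) \<in> card ` {I \<in> indep M. I \<subseteq> X}"
    by (rule Max_in) (auto simp: finite_indep intro!: exI[of _ "{}"] indep_empty)
  then show ?thesis using that unfolding rank_of_def by force
qed

lemma extend_to_basis:
  assumes "I \<in> indep M" "I \<subseteq> X"
  obtains B where "B \<in> indep M" "I \<subseteq> B" "B \<subseteq> X" "card B = rank_of M X"
proof -
  let ?S = "{J \<in> indep M. I \<subseteq> J \<and> J \<subseteq> X}"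
  have fin: "finite ?S" using finite_indep by simp
  have "Max (card ` ?S) \<in> card ` ?S"
    by (rule Max_in) (use fin assms in auto)
  then obtain B where B: "B \<in> ?S" "card B = Max (card ` ?S)" by force
  have "\<not> card B < rank_of M X"
  proof
    assume *: "card B < rank_of M X"
    obtain C where C: "C \<in> indep M" "C \<subseteq> X" "card C = rank_of M X" by (rule obtain_basis)
    then obtain x where x: "x \<in> C - B" "insert x B \<in> indep M"
      using indep_augment[of B C] B * by auto
    then have "insert x B \<in> ?S" using B C by auto
    then have "card (insert x B) \<le> Max (card ` ?S)" using fin by (intro Max_ge) auto
    with B x finite_of_indep show False by auto
  qed
  with card_le_rank[of B X] B have "card B = rank_of M X" by auto
  with B show ?thesis using that by auto
qed

lemma indep_contract_iff:
  assumes B: "B \<in> indep M" "B \<subseteq> F" "card B = rank_of M F" and I: "I \<subseteq> ground M - F"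
  shows "I \<in> indep (contract M F) \<longleftrightarrow> I \<union> B \<in> indep M"
proof -
  have finI: "finite I" using I finite_ground finite_subset by blast
  have disj: "I \<inter> B = {}" using B I by auto
  have finB: "finite B" using B finite_of_indep by auto
  obtain C where C: "C \<in> indep M" "B \<subseteq> C" "C \<subseteq> I \<union> F" "card C = rank_of M (I \<union> F)"
    by (rule extend_to_basis[of B "I \<union> F"]) (use B in auto)
  have finC: "finite C" using C finite_of_indep by auto
  have "card (C \<inter> F) \<le> card B"
    unfolding B(3) by (rule card_le_rank) (use C indep_mono in auto)
  then have CF: "C \<inter> F = B"
    using C B finC by (intro card_seteq[symmetric]) auto
  then have C_eq: "C = (C \<inter> I) \<union> B" using C by auto
  then have cardC: "card C = card (C \<inter> I) + card B"
    using finI finB disj by (metis card_Un_disjoint finite_Int inf_assoc inf_bot_right)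
  show ?thesis
  proof
    assume "I \<in> indep (contract M F)"
    then have "card C = card I + card B" using C B by (simp add: contract_def)
    with cardC have "card (C \<inter> I) = card I" by simp
    then have "C \<inter> I = I" using finI by (intro card_subset_eq) auto
    with C_eq C show "I \<union> B \<in> indep M" by simp
  next
    assume *: "I \<union> B \<in> indep M"
    have "card (I \<union> B) \<le> rank_of M (I \<union> F)"
      by (rule card_le_rank) (use * B in auto)
    moreover have "card (I \<union> B) = card I + card B"
      using finI finB disj by (simp add: card_Un_disjoint)
    moreover have "card (C \<inter> I) \<le> card I" using finI by (simp add: card_mono)
    ultimately show "I \<in> indep (contract M F)"
      using cardC C B I by (simp add: contract_def)
  qed
qed

lemma matroid_contract: "matroid (contract M F)"
proof -
  obtain B where B: "B \<in> indep M" "B \<subseteq> F" "card B = rank_of M F" by (rule obtain_basis)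
  note iff = indep_contract_iff[OF B]
  have sub: "I \<subseteq> ground M - F" if "I \<in> indep (contract M F)" for I
    using that by (auto simp: contract_def)
  show ?thesis
  proof
    show "finite (ground (contract M F))" using finite_ground by (simp add: contract_def)
    show "I \<subseteq> ground (contract M F)" if "I \<in> indep (contract M F)" for I
      using that by (auto simp: contract_def)
    show "{} \<in> indep (contract M F)" by (simp add: contract_def)
    show "J \<in> indep (contract M F)" if "I \<in> indep (contract M F)" "J \<subseteq> I" for I J
    proof -
      have IB: "I \<union> B \<in> indep M" using iff[of I] sub[of I] that by simp
      have "J \<union> B \<in> indep M" by (rule indep_mono[OF IB]) (use that in auto)
      then show ?thesis using iff[of J] sub[of I] that by auto
    qed
    show "\<exists>x\<in>J - I. insert x I \<in> indep (contract M F)"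
      if I: "I \<in> indep (contract M F)" and J: "J \<in> indep (contract M F)" and "card I < card J" for I J
    proof -
      have IB: "I \<union> B \<in> indep M" and JB: "J \<union> B \<in> indep M"
        using iff[of I] iff[of J] sub[of I] sub[of J] I J by auto
      have "I \<inter> B = {}" "J \<inter> B = {}" using sub[OF I] sub[OF J] B by auto
      then have "card (I \<union> B) < card (J \<union> B)"
        using finite_of_indep[OF IB] finite_of_indep[OF JB] that(3) by (simp add: card_Un_disjoint)
      then obtain x where x: "x \<in> (J \<union> B) - (I \<union> B)" "insert x (I \<union> B) \<in> indep M"
        using indep_augment[OF IB JB] by auto
      then have "insert x I \<in> indep (contract M F)"
        using iff[of "insert x I"] sub[OF I] sub[OF J] by auto
      with x show ?thesis by auto
    qed
  qed
qed

lemma rank_contract: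
  assumes "X \<subseteq> ground M - F"
  shows "rank_of (contract M F) X + rank_of M F = rank_of M (X \<union> F)"
proof (rule antisym)
  interpret N: matroid "contract M F" by (rule matroid_contract)
  obtain B where B: "B \<in> indep M" "B \<subseteq> F" "card B = rank_of M F" by (rule obtain_basis)
  have finB: "finite B" using B finite_of_indep by auto
  obtain I where I: "I \<in> indep (contract M F)" "I \<subseteq> X" "card I = rank_of (contract M F) X"
    by (rule N.obtain_basis)
  then have "I \<union> B \<in> indep M" using indep_contract_iff[OF B, of I] assms by auto
  then have "card (I \<union> B) \<le> rank_of M (X \<union> F)" using I B by (intro card_le_rank) auto
  moreover have "I \<inter> B = {}" using I assms B by auto
  ultimately show "rank_of (contract M F) X + rank_of M F \<le> rank_of M (X \<union> F)"
    using I B finB N.finite_of_indep[of I] by (simp add: card_Un_disjoint)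
  obtain C where C: "C \<in> indep M" "B \<subseteq> C" "C \<subseteq> X \<union> F" "card C = rank_of M (X \<union> F)"
    by (rule extend_to_basis[of B "X \<union> F"]) (use B in auto)
  have finC: "finite C" using C finite_of_indep by auto
  have "card (C \<inter> F) \<le> card B"
    unfolding B(3) by (rule card_le_rank) (use C indep_mono in auto)
  then have CF: "C \<inter> F = B"
    using C B finC by (intro card_seteq[symmetric]) auto
  have "(C - F) \<union> B = C" using CF C by auto
  then have "C - F \<in> indep (contract M F)"
    using indep_contract_iff[OF B, of "C - F"] assms C by auto
  then have "card (C - F) \<le> rank_of (contract M F) X"
    using C by (intro N.card_le_rank) auto
  moreover have "card C = card (C - F) + card B"
    using CF finC finB by (metis add.commute card_Int_Diff)
  ultimately show "rank_of M (X \<union> F) \<le> rank_of (contract M F) X + rank_of M F"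
    using C B by simp
qed

lemma flat_subset: "F \<in> flats M \<Longrightarrow> F \<subseteq> ground M"
  by (auto simp: flats_def)

lemma finite_flats: "finite (flats M)"
  by (rule finite_subset[of _ "Pow (ground M)"]) (auto simp: flats_def finite_ground)

lemma rk_contract: "F \<subseteq> ground M \<Longrightarrow> rk (contract M F) + rank_of M F = rk M"
  using rank_contract[of "ground M - F" F]
  by (simp add: contract_def Un_absorb2)

lemma loopless_contract:
  assumes "F \<in> flats M"
  shows "loopless (contract M F)"
  unfolding loopless_def
proof
  fix x assume "x \<in> ground (contract M F)"
  then have x: "x \<in> ground M - F" by (simp add: contract_def)
  obtain B where B: "B \<in> indep M" "B \<subseteq> F" "card B = rank_of M F" by (rule obtain_basis)
  have finB: "finite B" using B finite_of_indep by auto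
  obtain C where C: "C \<in> indep M" "B \<subseteq> C" "C \<subseteq> insert x F" "card C = rank_of M (insert x F)"
    by (rule extend_to_basis[of B "insert x F"]) (use B in auto)
  have finC: "finite C" using C finite_of_indep by auto
  have "card (C \<inter> F) \<le> card B"
    unfolding B(3) by (rule card_le_rank) (use C indep_mono in auto)
  then have CF: "C \<inter> F = B"
    using C B finC by (intro card_seteq[symmetric]) auto
  have "card B < card C" using assms x B C by (auto simp: flats_def)
  then have "C \<noteq> B" by auto
  then have "C = {x} \<union> B" using CF C by auto
  then show "{x} \<in> indep (contract M F)"
    using indep_contract_iff[OF B, of "{x}"] C x by auto
qed

lemma rank_empty [simp]: "rank_of M {} = 0"
proof -
  obtain B where "B \<in> indep M" "B \<subseteq> {}" "card B = rank_of M {}" by (rule obtain_basis)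
  then show ?thesis by auto
qed

lemma rank_pos:
  assumes "loopless M" "F \<subseteq> ground M" "F \<noteq> {}"
  shows "rank_of M F > 0"
proof -
  from assms obtain x where "x \<in> F" "{x} \<in> indep M" by (auto simp: loopless_def)
  then have "card {x} \<le> rank_of M F" by (intro card_le_rank) auto
  then show ?thesis by simp
qed

lemma empty_flat: "loopless M \<Longrightarrow> {} \<in> flats M"
  using rank_pos by (auto simp: flats_def)

lemma ground_flat: "ground M \<in> flats M"
  by (auto simp: flats_def)

lemma rank_flat_less:
  assumes "F \<in> flats M" "F \<noteq> ground M"
  shows "rank_of M F < rk M"
proof -
  interpret N: matroid "contract M F" by (rule matroid_contract)
  have "rk (contract M F) > 0"
    by (rule N.rank_pos[OF loopless_contract[OF assms(1)]])
       (use assms flat_subset in \<open>auto simp: contract_def\<close>)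
  then show ?thesis using rk_contract[OF flat_subset[OF assms(1)]] by linarith
qed

lemma contract_empty: "contract M {} = (M :: 'a pre_matroid)"
proof -
  have "I \<in> indep M \<longleftrightarrow> I \<in> indep (contract M {})" for I
    using indep_contract_iff[of "{}" "{}" I] indep_empty indep_subset_ground[of I]
    by (auto simp: contract_def)
  then have "indep (contract M {}) = indep M" by blast
  then show ?thesis by (intro pre_matroid.equality) (auto simp: contract_def)
qed

end

text \<open>
  Given the polynomials of the proper contractions, the palindromicity condition determines
  the coefficients of \<open>P\<close> in degrees below half the rank.
\<close>

function kl_rec :: "'a pre_matroid \<Rightarrow> int poly" where
  "kl_rec M = (if matroid M \<and> loopless M \<and> rk M > 0
     then (let Q = (\<Sum>F\<in>flats M - {{}}. monom 1 (rank_of M F) * kl_rec (contract M F))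
           in \<Sum>i | 2 * i < rk M. monom (coeff Q (rk M - i) - coeff Q i) i)
     else 1)"
  by auto
termination
proof (relation "measure rk")
  fix M :: "'a pre_matroid" and F
  assume M: "matroid M \<and> loopless M \<and> rk M > 0" and F: "F \<in> flats M - {{}}"
  then interpret matroid M by simp
  have "rank_of M F > 0" using rank_pos F M flat_subset by blast
  then have "rk (contract M F) < rk M"
    using rk_contract[of F] F flat_subset by fastforce
  then show "(contract M F, M) \<in> measure rk" by simp
qed simp

declare kl_rec.simps [simp del]

lemma finite_half: "finite {i::nat. 2 * i < r}"
  by (rule finite_subset[of _ "{..r}"]) auto

lemma degree_kl_rec:
  assumes "rk M > 0"
  shows "2 * degree (kl_rec M) < rk M"
proof -
  let ?n = "(rk M - 1) div 2"
  have *: "degree (\<Sum>i | 2 * i < rk M. monom (c i) i) \<le> ?n" for c :: "nat \<Rightarrow> int"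
    by (rule degree_sum_le) (auto simp: finite_half intro!: order.trans[OF degree_monom_le])
  have "degree (kl_rec M) \<le> ?n"
    by (subst kl_rec.simps) (use * in \<open>auto simp: Let_def\<close>)
  then show ?thesis using assms by linarith
qed

lemma kl_rec_rank_0: "rk M = 0 \<Longrightarrow> kl_rec M = 1"
  by (subst kl_rec.simps) simp

lemma Z_poly_split:
  assumes "matroid M" "loopless M"
  shows "Z_poly P M =
    P M + (\<Sum>F\<in>flats M - {{}}. monom 1 (rank_of M F) * P (contract M F))"
proof -
  interpret matroid M by fact
  show ?thesis
    unfolding Z_poly_def using finite_flats empty_flat[OF assms(2)]
    by (subst sum.remove[of _ "{}"]) (auto simp: contract_empty monom_0 one_pCons[symmetric])
qed

lemma coeff_Z_poly_rank:
  assumes M: "matroid M" "loopless M"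
    and 0: "\<And>N. matroid N \<Longrightarrow> loopless N \<Longrightarrow> rk N = 0 \<Longrightarrow> P N = 1"
    and deg: "\<And>N. matroid N \<Longrightarrow> loopless N \<Longrightarrow> rk N > 0 \<Longrightarrow> 2 * degree (P N) < rk N"
  shows "coeff (Z_poly P M) (rk M) = 1" "degree (Z_poly P M) = rk M"
proof -
  interpret matroid M by fact
  have low: "degree (monom 1 (rank_of M F) * P (contract M F)) < rk M"
    if F: "F \<in> flats M" "F \<noteq> ground M" for F
  proof -
    have r: "rk (contract M F) + rank_of M F = rk M" by (rule rk_contract[OF flat_subset[OF F(1)]])
    with rank_flat_less[OF F] have "rk (contract M F) > 0" by linarith
    from deg[OF matroid_contract loopless_contract[OF F(1)] this]
    have "rank_of M F + degree (P (contract M F)) < rk M" using r by linarith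
    moreover have "degree (monom 1 (rank_of M F) * P (contract M F))
        \<le> rank_of M F + degree (P (contract M F))"
      by (rule order.trans[OF degree_mult_le]) (simp add: degree_monom_eq)
    ultimately show ?thesis by linarith
  qed
  have top: "P (contract M (ground M)) = 1"
    using rk_contract[of "ground M"] 0[OF matroid_contract loopless_contract[OF ground_flat]] by simp
  let ?R = "\<Sum>F\<in>flats M - {ground M}. monom 1 (rank_of M F) * P (contract M F)"
  have Z: "Z_poly P M = monom 1 (rk M) + ?R"
    unfolding Z_poly_def using finite_flats ground_flat
    by (subst sum.remove[of _ "ground M"]) (auto simp: top)
  have "coeff ?R (rk M) = 0"
    unfolding coeff_sum using low by (intro sum.neutral ballI coeff_eq_0) auto
  then show c: "coeff (Z_poly P M) (rk M) = 1" by (simp add: Z)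
  have "degree ?R \<le> rk M"
    using low finite_flats by (intro degree_sum_le) (auto intro: less_imp_le)
  then have "degree (Z_poly P M) \<le> rk M"
    unfolding Z by (intro degree_add_le) (auto simp: degree_monom_eq)
  moreover have "rk M \<le> degree (Z_poly P M)" using c by (intro le_degree) simp
  ultimately show "degree (Z_poly P M) = rk M" by simp
qed

theorem kl_family_exists: "kl_family kl_rec"
  unfolding kl_family_def
proof (intro allI impI conjI)
  fix M :: "'a pre_matroid" assume M: "matroid M" "loopless M"
  show "rk M = 0 \<Longrightarrow> kl_rec M = 1" by (rule kl_rec_rank_0)
  show "rk M > 0 \<Longrightarrow> 2 * degree (kl_rec M) < rk M" by (rule degree_kl_rec)
  let ?Z = "Z_poly kl_rec M"
  note top = coeff_Z_poly_rank[of M kl_rec, OF M kl_rec_rank_0 degree_kl_rec]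
  show deg: "degree ?Z = rk M" using top(2) by simp
  define Q where "Q = (\<Sum>F\<in>flats M - {{}}. monom 1 (rank_of M F) * kl_rec (contract M F))"
  have Z: "?Z = kl_rec M + Q" unfolding Q_def by (rule Z_poly_split[OF M])
  have pal: "coeff ?Z (rk M - i) = coeff ?Z i" if i: "2 * i < rk M" for i
  proof -
    have kl: "kl_rec M = (\<Sum>i | 2 * i < rk M. monom (coeff Q (rk M - i) - coeff Q i) i)"
      using M i unfolding Q_def by (subst kl_rec.simps) (auto simp: Let_def)
    have "coeff (kl_rec M) i = coeff Q (rk M - i) - coeff Q i"
      using i unfolding kl coeff_sum coeff_monom
      by (subst sum.delta) (auto simp: finite_half)
    moreover have "coeff (kl_rec M) (rk M - i) = 0"
      using degree_kl_rec[of M] i by (intro coeff_eq_0) linarith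
    ultimately show ?thesis unfolding Z by simp
  qed
  have "coeff ?Z (rk M - i) = coeff ?Z i" if i: "i \<le> rk M" for i
  proof -
    consider "2 * i < rk M" | "2 * (rk M - i) < rk M" | "rk M - i = i" using i by linarith
    then show ?thesis
    proof cases
      case 2
      then show ?thesis using pal[of "rk M - i"] i by simp
    qed (use pal in auto)
  qed
  then show "reflect_poly ?Z = ?Z"
    by (auto simp: poly_eq_iff coeff_reflect_poly deg coeff_eq_0)
qed

theorem kl_family_unique:
  assumes P: "kl_family P" and Q: "kl_family Q" and M: "matroid M" "loopless M"
  shows "P M = Q M"
  using M
proof (induction "rk M" arbitrary: M rule: less_induct)
  case less
  interpret matroid M by fact
  have P': "rk M = 0 \<Longrightarrow> P M = 1" "rk M > 0 \<Longrightarrow> 2 * degree (P M) < rk M"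
    "degree (Z_poly P M) = rk M" "reflect_poly (Z_poly P M) = Z_poly P M"
    using P less.prems by (auto simp: kl_family_def)
  have Q': "rk M = 0 \<Longrightarrow> Q M = 1" "rk M > 0 \<Longrightarrow> 2 * degree (Q M) < rk M"
    "degree (Z_poly Q M) = rk M" "reflect_poly (Z_poly Q M) = Z_poly Q M"
    using Q less.prems by (auto simp: kl_family_def)
  show ?case
  proof (cases "rk M = 0")
    case True
    then show ?thesis using P' Q' by simp
  next
    case False
    define R where "R = (\<Sum>F\<in>flats M - {{}}. monom 1 (rank_of M F) * P (contract M F))"
    have "R = (\<Sum>F\<in>flats M - {{}}. monom 1 (rank_of M F) * Q (contract M F))"
      unfolding R_def
    proof (intro sum.cong refl arg_cong2[where f = "(*)"])
      fix F assume F: "F \<in> flats M - {{}}"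
      then have "rk (contract M F) < rk M"
        using rk_contract[of F] flat_subset[of F] rank_pos[of F] less.prems by force
      with F show "P (contract M F) = Q (contract M F)"
        by (intro less.hyps matroid_contract loopless_contract) auto
    qed
    then have ZP: "Z_poly P M = P M + R" and ZQ: "Z_poly Q M = Q M + R"
      unfolding R_def using Z_poly_split[OF less.prems] by auto
    show ?thesis
    proof (rule poly_eqI)
      fix i
      show "coeff (P M) i = coeff (Q M) i"
      proof (cases "2 * i < rk M")
        case True
        have "coeff (Z_poly P M) i = coeff (Z_poly P M) (rk M - i)"
          using True P'(3,4) coeff_reflect_poly[of "Z_poly P M" i] by simp
        moreover have "coeff (Z_poly Q M) i = coeff (Z_poly Q M) (rk M - i)"
          using True Q'(3,4) coeff_reflect_poly[of "Z_poly Q M" i] by simp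
        moreover have "coeff (P M) (rk M - i) = 0" "coeff (Q M) (rk M - i) = 0"
          using True P'(2) Q'(2) by (auto intro!: coeff_eq_0)
        ultimately show ?thesis unfolding ZP ZQ by simp
      next
        case i: False
        have "coeff (P M) i = 0" "coeff (Q M) i = 0"
          using False i P'(2) Q'(2) by (auto intro!: coeff_eq_0)
        then show ?thesis by simp
      qed
    qed
  qed
qed

theorem kl_poly_eq:
  assumes "kl_family P" "matroid M" "loopless M"
  shows "kl_poly M = P M"
  unfolding kl_poly_def
  by (rule the_equality) (use assms kl_family_unique in blast)+

end

theory Submission
  imports
    Defs
    "HOL-Library.Cardinality"
    "HOL-Computational_Algebra.Fundamental_Theorem_Algebra"
begin

text \<open>
  Let \<open>V\<close> be a vector space over a finite field and \<open>D\<close> a set of vectors containing \<open>0\<close> whose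
  span has dimension less than \<open>dim V / 2\<close>. Then the matroid \<open>M\<close> of the vectors in \<open>V - D\<close> has
  the Kazhdan--Lusztig polynomial \<open>\<Sum> t ^ dim U\<close>, where \<open>U\<close> runs over the subspaces contained
  in \<open>D\<close>. More generally, let \<open>P\<^sub>F\<close> be the sum of \<open>t ^ (dim U - rk F)\<close> over all subspaces \<open>U\<close>
  that meet \<open>V - D\<close> exactly in the flat \<open>F\<close>. As every \<open>U\<close> meets \<open>V - D\<close> in exactly one flat,
  the polynomial \<open>Z\<close> built from the \<open>P\<^sub>F\<close> counts all subspaces between the span of \<open>F\<close> and \<open>V\<close>
  by dimension, and it is palindromic by the symmetry of the Gaussian binomial coefficients.
  The bound on the dimension of the span of \<open>D\<close> is the degree bound.

  For \<open>D\<close> take the union of a space of dimension \<open>k\<close> and \<open>N\<close> independent lines. The lines only add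
  \<open>N\<close> to the linear coefficient, so for \<open>k = 6\<close> and large \<open>N\<close> the coefficients of \<open>t\<close>, \<open>t\<^sup>2\<close>, \<open>t\<^sup>3\<close>
  form a valley. For \<open>k = 3\<close> and large \<open>N\<close> the sum of the squares of the three zeros is negative.
\<close>

subsection \<open>Gaussian binomial coefficients\<close>

text \<open>This is the Pascal rule that a hyperplane produces in
  \<open>card_subspace_interval\<close>: \<open>n - k\<close> is the codimension of a
  \<open>k\<close>-dimensional subspace in a hyperplane of dimension \<open>n\<close>. The recursion
  avoids the division of the product formula.\<close>

fun gauss_binomial :: "nat \<Rightarrow> nat \<Rightarrow> nat \<Rightarrow> nat" where
  "gauss_binomial q n 0 = 1"
| "gauss_binomial q 0 (Suc k) = 0"
| "gauss_binomial q (Suc n) (Suc k) =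
     gauss_binomial q n (Suc k) + q ^ (n - k) * gauss_binomial q n k"

lemma gauss_binomial_eq_0: "n < k \<Longrightarrow> gauss_binomial q n k = 0"
  by (induction q n k rule: gauss_binomial.induct) auto

lemma gauss_binomial_self: "gauss_binomial q n n = 1"
  by (induction n) (auto simp: gauss_binomial_eq_0)

text \<open>The dual Pascal rule. After one expansion by the defining rule and the induction
  hypothesis for both summands, the regrouping rests on
  \<open>q ^ (Suc n - k) * q ^ k = q ^ Suc k * q ^ (n - k)\<close>.\<close>

lemma gauss_binomial_Suc_Suc':
  "k \<le> n \<Longrightarrow> gauss_binomial q (Suc n) (Suc k) =
     gauss_binomial q n k + q ^ Suc k * gauss_binomial q n (Suc k)"
proof (induction n arbitrary: k)
  case 0
  then show ?case by simp
next
  case (Suc n)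
  show ?case
  proof (cases k)
    case 0
    let ?g = "\<lambda>m. gauss_binomial q m (Suc 0)"
    have "?g (Suc (Suc n)) = ?g (Suc n) + q * q ^ n" by simp
    also have "?g (Suc n) = 1 + q * ?g n" using Suc.IH[of 0] by simp
    also have "1 + q * ?g n + q * q ^ n = 1 + q * ?g (Suc n)" by (simp add: algebra_simps)
    finally show ?thesis using 0 by simp
  next
    case k: (Suc j)
    show ?thesis
    proof (cases "k = Suc n")
      case True
      then show ?thesis by (simp add: gauss_binomial_eq_0)
    next
      case False
      then have "k \<le> n" using Suc.prems by simp
      have "gauss_binomial q (Suc (Suc n)) (Suc k) =
          gauss_binomial q (Suc n) (Suc k) + q ^ (Suc n - k) * gauss_binomial q (Suc n) k"
        by simp
      also have "\<dots> = (gauss_binomial q n k + q ^ Suc k * gauss_binomial q n (Suc k))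
          + q ^ (Suc n - k) * (gauss_binomial q n j + q ^ k * gauss_binomial q n k)"
        using Suc.IH[of k] Suc.IH[of j] \<open>k \<le> n\<close> k by simp
      also have "\<dots> = (gauss_binomial q n k + q ^ (n - j) * gauss_binomial q n j)
          + q ^ Suc k * (gauss_binomial q n (Suc k) + q ^ (n - k) * gauss_binomial q n k)"
        using \<open>k \<le> n\<close> k
        by (simp add: algebra_simps flip: power_add power_Suc)
      also have "\<dots> = gauss_binomial q (Suc n) k + q ^ Suc k * gauss_binomial q (Suc n) (Suc k)"
        unfolding k by simp
      finally show ?thesis .
    qed
  qed
qed

text \<open>Replacing \<open>k\<close> by \<open>n - k\<close> exchanges the two Pascal rules, so
  one side is expanded by the defining rule and the other by its dual.\<close>

lemma gauss_binomial_symmetric: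
  "k \<le> n \<Longrightarrow> gauss_binomial q n (n - k) = gauss_binomial q n k"
proof (induction n arbitrary: k)
  case (Suc n)
  show ?case
  proof (cases k)
    case 0
    then show ?thesis using gauss_binomial_self[of q "Suc n"] by simp
  next
    case k: (Suc j)
    show ?thesis
    proof (cases "k = Suc n")
      case True
      then show ?thesis using gauss_binomial_self[of q "Suc n"] by simp
    next
      case False
      then have "k \<le> n" using Suc.prems by simp
      then have e: "Suc n - k = Suc (n - k)" "n - j = Suc (n - k)" using k by auto
      have "gauss_binomial q (Suc n) (Suc n - k) =
          gauss_binomial q n (n - j) + q ^ k * gauss_binomial q n (n - k)"
        unfolding e using \<open>k \<le> n\<close> by simp
      also have "\<dots> = gauss_binomial q n j + q ^ k * gauss_binomial q n k"
        using Suc.IH[of j] Suc.IH[of k] \<open>k \<le> n\<close> k by simp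
      also have "\<dots> = gauss_binomial q (Suc n) k"
        using gauss_binomial_Suc_Suc'[of j n q] \<open>k \<le> n\<close> k by simp
      finally show ?thesis .
    qed
  qed
qed simp

subsection \<open>Counting subspaces\<close>

context vector_space
begin

lemma subspace_scale_iff:
  assumes "subspace S"
  shows "scale c x \<in> S \<longleftrightarrow> c = 0 \<or> x \<in> S"
proof
  assume "scale c x \<in> S"
  then have "scale (inverse c) (scale c x) \<in> S" using assms by (rule subspace_scale[rotated])
  then show "c = 0 \<or> x \<in> S" by (cases "c = 0") auto
qed (use assms in \<open>auto intro: subspace_0 subspace_scale\<close>)

text \<open>Finiteness of the set stands in for finite dimension of the ambient space, because the
  counterexamples live in the infinite-dimensional space of all sequences over the field.\<close>

lemma dim_insert_finite:
  assumes "finite S" "x \<notin> span S"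
  shows "dim (insert x S) = Suc (dim S)"
proof -
  obtain B where B: "B \<subseteq> S" "independent B" "S \<subseteq> span B" "card B = dim S"
    by (rule basis_exists)
  have eq: "span B = span S"
    using B by (metis span_eq span_mono span_superset subset_trans)
  have "x \<notin> B" using assms eq span_base by blast
  have "dim (insert x S) = card (insert x B)"
  proof (rule dim_eq_card)
    show "span (insert x B) = span (insert x S)"
      using eq by (metis span_insert)
    show "independent (insert x B)" using B assms eq by (simp add: independent_insertI)
  qed
  then show ?thesis
    using \<open>x \<notin> B\<close> B assms(1) finite_subset[of B S] by simp
qed

lemma dim_mono_finite:
  assumes "finite T" "S \<subseteq> span T"
  shows "dim S \<le> dim T"
proof -
  obtain B where B: "B \<subseteq> T" "independent B" "T \<subseteq> span B" "card B = dim T"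
    by (rule basis_exists)
  have "S \<subseteq> span B" using assms B by (metis span_minimal subspace_span subset_trans)
  then show ?thesis using B assms(1) finite_subset[of B T] dim_le_card by metis
qed

text \<open>A vector of the larger span is \<open>scale c x + y\<close> with \<open>y\<close> in
  \<open>span S\<close> in exactly one way: two different scalars would put \<open>x\<close> into
  \<open>span S\<close>.\<close>

lemma card_span_insert:
  assumes "x \<notin> span S"
  shows "card (span (insert x S)) = CARD('a) * card (span S)"
proof -
  have "bij_betw (\<lambda>(c, y). scale c x + y) (UNIV \<times> span S) (span (insert x S))"
    unfolding bij_betw_def
  proof
    show "inj_on (\<lambda>(c, y). scale c x + y) (UNIV \<times> span S)"
    proof (clarsimp simp: inj_on_def)
      fix c y c' y' assume y: "y \<in> span S" "y' \<in> span S" and e: "scale c x + y = scale c' x + y'"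
      then have "scale (c - c') x = y' - y" by (simp add: algebra_simps)
      then have "scale (c - c') x \<in> span S" using y by (simp add: span_diff)
      then have "c = c'"
        using assms subspace_scale_iff[of "span S"] by auto
      with e show "c = c' \<and> y = y'" by simp
    qed
    show "(\<lambda>(c, y). scale c x + y) ` (UNIV \<times> span S) = span (insert x S)"
    proof (intro set_eqI iffI)
      fix z assume "z \<in> span (insert x S)"
      then obtain c where "z - scale c x \<in> span S" by (auto simp: span_insert)
      then show "z \<in> (\<lambda>(c, y). scale c x + y) ` (UNIV \<times> span S)"
        by (intro image_eqI[of _ _ "(c, z - scale c x)"]) auto
    next
      fix z assume "z \<in> (\<lambda>(c, y). scale c x + y) ` (UNIV \<times> span S)"
      then obtain c y where "z = scale c x + y" "y \<in> span S" by auto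
      then show "z \<in> span (insert x S)" by (auto simp: span_insert intro: exI[of _ c])
    qed
  qed
  then have "card (span (insert x S)) = card ((UNIV :: 'a set) \<times> span S)"
    by (metis bij_betw_same_card)
  then show ?thesis by (simp add: card_cartesian_product)
qed

lemma card_subspace:
  assumes "subspace U" "finite U"
  shows "card U = CARD('a) ^ dim U"
proof -
  obtain B where B: "B \<subseteq> U" "independent B" "U \<subseteq> span B" "card B = dim U"
    by (rule basis_exists)
  have "finite B" using B assms finite_subset by blast
  then have "card (span B) = CARD('a) ^ card B" using B(2)
  proof (induction B)
    case (insert x B)
    then have "x \<notin> span B" "independent B" by (auto simp: independent_insert)
    with insert show ?case by (simp add: card_span_insert)
  qed simp
  moreover have "span B = U" using B assms by (metis span_subspace)
  ultimately show ?thesis using B by simp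
qed

text \<open>By \<open>card_subspace\<close>, equal dimensions mean equal finite
  cardinalities.\<close>

lemma subspace_eqI_dim:
  assumes "subspace U" "subspace W" "U \<subseteq> W" "finite W" "dim U = dim W"
  shows "U = W"
  using assms card_subspace[of U] card_subspace[of W] finite_subset[of U W]
  by (metis card_subset_eq)

text \<open>A basis of \<open>W\<close> together with some \<open>x\<close> in \<open>V - W\<close>
  extends to a basis of \<open>V\<close>; the hyperplane is spanned by that basis without
  \<open>x\<close>.\<close>

lemma exists_hyperplane:
  assumes W: "subspace W" and V: "subspace V" "finite V" and "W \<subset> V"
  obtains H where "subspace H" "W \<subseteq> H" "H \<subseteq> V" "dim V = Suc (dim H)"
proof -
  obtain x where x: "x \<in> V" "x \<notin> W" using assms by auto
  obtain B where B: "B \<subseteq> W" "independent B" "W \<subseteq> span B" "card B = dim W"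
    by (rule basis_exists)
  have spB: "span B = W" using B W by (metis span_subspace)
  then have "independent (insert x B)" using x B independent_insertI by auto
  moreover have "insert x B \<subseteq> V" using x B assms by auto
  ultimately obtain C where C: "insert x B \<subseteq> C" "C \<subseteq> V" "independent C" "V \<subseteq> span C"
    by (metis maximal_independent_subset_extend)
  have finC: "finite C" using C V finite_subset by blast
  show ?thesis
  proof
    show "subspace (span (C - {x}))" by simp
    have "x \<notin> B" using x B by auto
    then show "W \<subseteq> span (C - {x})" using C spB span_mono[of B "C - {x}"] by auto
    show "span (C - {x}) \<subseteq> V" using C V by (intro span_minimal) auto
    have "dim V = card C" using C basis_card_eq_dim by metis
    moreover have "dim (span (C - {x})) = card (C - {x})"
      using C independent_mono[of C "C - {x}"] by (intro dim_span_eq_card_independent) auto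
    moreover have "card C = Suc (card (C - {x}))"
      using C finC card_Suc_Diff1[of C x] by auto
    ultimately show "dim V = Suc (dim (span (C - {x})))" by simp
  qed
qed

section \<open>Subspaces in relation to a hyperplane\<close>

context
  fixes V H
  assumes V: "subspace V" "finite V" and H: "subspace H" "H \<subseteq> V" "dim V = Suc (dim H)"
begin

lemma span_insert_hyperplane:
  assumes "x \<in> V - H"
  shows "span (insert x H) = V"
proof (rule subspace_eqI_dim)
  show sub: "span (insert x H) \<subseteq> V" using V H assms by (intro span_minimal) auto
  have "x \<notin> span H" using assms H by (metis DiffD2 span_eq_iff)
  then show "dim (span (insert x H)) = dim V"
    using H dim_insert_finite[OF finite_subset[OF H(2) V(2)]] by simp
qed (use V in auto)

text \<open>Since \<open>x\<close> and \<open>H\<close> span \<open>V\<close>, each \<open>y\<close>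
  in \<open>U\<close> differs from a multiple of \<open>x\<close> by a vector of \<open>H\<close>,
  and this vector lies in \<open>U\<close> as well.\<close>

lemma subspace_eq_span_insert_hyperplane:
  assumes U: "subspace U" "U \<subseteq> V" and x: "x \<in> U - H"
  shows "U = span (insert x (U \<inter> H))"
proof
  show "span (insert x (U \<inter> H)) \<subseteq> U" using U x by (intro span_minimal) auto
  show "U \<subseteq> span (insert x (U \<inter> H))"
  proof
    fix y assume y: "y \<in> U"
    then have "y \<in> span (insert x H)" using span_insert_hyperplane[of x] U x by auto
    then obtain c where c: "y - scale c x \<in> H"
      using H by (auto simp: span_insert span_eq_iff[THEN iffD2])
    moreover have "y - scale c x \<in> U" using U x y by (auto intro: subspace_diff subspace_scale)
    ultimately have "y - scale c x \<in> span (U \<inter> H)" by (intro span_base) auto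
    then show "y \<in> span (insert x (U \<inter> H))" by (auto simp: span_insert)
  qed
qed

lemma dim_Int_hyperplane:
  assumes U: "subspace U" "U \<subseteq> V" and "\<not> U \<subseteq> H"
  shows "dim U = Suc (dim (U \<inter> H))"
proof -
  obtain x where x: "x \<in> U - H" using assms by auto
  have sp: "span (U \<inter> H) = U \<inter> H" using U H by (simp add: subspace_inter)
  have "dim U = dim (insert x (U \<inter> H))"
    using subspace_eq_span_insert_hyperplane[OF U x] dim_span by metis
  also have "\<dots> = Suc (dim (U \<inter> H))"
  proof (rule dim_insert_finite)
    show "finite (U \<inter> H)" using U V finite_subset by blast
    show "x \<notin> span (U \<inter> H)" unfolding sp using x by simp
  qed
  finally show ?thesis .
qed

lemma span_insert_Int_hyperplane:
  assumes W: "subspace W" "W \<subseteq> H" and x: "x \<in> V - H"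
  shows "span (insert x W) \<inter> H = W"
proof
  show "W \<subseteq> span (insert x W) \<inter> H" using W by (auto intro: span_base)
  show "span (insert x W) \<inter> H \<subseteq> W"
  proof
    fix y assume y: "y \<in> span (insert x W) \<inter> H"
    then obtain c where c: "y - scale c x \<in> W"
      using W by (auto simp: span_insert span_eq_iff[THEN iffD2])
    then have "scale c x \<in> H"
      using y W H subspace_diff[of H y "y - scale c x"] by auto
    then have "c = 0" using x H subspace_scale_iff by auto
    with c show "y \<in> W" by simp
  qed
qed

text \<open>The sets \<open>U - H\<close> partition \<open>V - H\<close>: through each \<open>x\<close> there is only \<open>span (insert x W)\<close>.\<close>

lemma card_subspaces_meeting_hyperplane:
  assumes W: "subspace W" "W \<subseteq> H" and q: "finite (UNIV :: 'a set)"
  shows "card {U. subspace U \<and> U \<subseteq> V \<and> \<not> U \<subseteq> H \<and> U \<inter> H = W}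
    = CARD('a) ^ (dim H - dim W)" (is "card ?X = _")
proof -
  let ?q = "CARD('a)"
  have q1: "?q > 1"
    using card_mono[OF q, of "{0, 1}"] by simp
  have finV: "finite A" if "A \<subseteq> V" for A using that V finite_subset by blast
  have finX: "finite ?X" by (rule finite_subset[of _ "Pow V"]) (use V in auto)
  \<comment> \<open>\<open>U\<close> has dimension \<open>dim W + 1\<close> and \<open>U - H\<close>
    removes just \<open>W\<close>, so all blocks have the same size.\<close>
  have card_diff: "card (U - H) = (?q - 1) * ?q ^ dim W" if U: "U \<in> ?X" for U
  proof -
    have "card (U - H) = card U - card W"
      using U card_Diff_subset_Int[of U H] finV by auto
    moreover have "card U = ?q ^ Suc (dim W)"
      using U dim_Int_hyperplane[of U] card_subspace[of U] finV by auto
    moreover have "card W = ?q ^ dim W" using W H finV by (intro card_subspace) auto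
    ultimately show ?thesis by (simp add: algebra_simps)
  qed
  have cover: "\<Union> ((\<lambda>U. U - H) ` ?X) = V - H"
  proof (intro equalityI subsetI)
    fix x assume x: "x \<in> V - H"
    have "span (insert x W) \<in> ?X"
      using span_insert_Int_hyperplane[OF W x] x W V H span_base[of x "insert x W"]
        span_minimal[of "insert x W" V] by auto
    then show "x \<in> \<Union> ((\<lambda>U. U - H) ` ?X)"
      using x span_base[of x "insert x W"] by blast
  qed auto
  have uniq: "U = span (insert x W)" if "U \<in> ?X" "x \<in> U - H" for U x
    using that subspace_eq_span_insert_hyperplane[of U x] by auto
  have ne: "U - H \<noteq> {}" if "U \<in> ?X" for U using that by auto
  \<comment> \<open>\<open>card_partition\<close> counts the blocks \<open>U - H\<close>, not the
    subspaces; a nonempty block determines its subspace.\<close>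
  have inj: "inj_on (\<lambda>U. U - H) ?X"
    using uniq ne unfolding inj_on_def by (metis (no_types, lifting) ex_in_conv)
  have "(?q - 1) * ?q ^ dim W * card ((\<lambda>U. U - H) ` ?X) = card (\<Union> ((\<lambda>U. U - H) ` ?X))"
  proof (rule card_partition)
    show "finite ((\<lambda>U. U - H) ` ?X)" using finX by (rule finite_imageI)
    show "finite (\<Union> ((\<lambda>U. U - H) ` ?X))" unfolding cover using V by simp
    show "card A = (?q - 1) * ?q ^ dim W" if "A \<in> (\<lambda>U. U - H) ` ?X" for A
      using that card_diff by blast
    fix A B assume A: "A \<in> (\<lambda>U. U - H) ` ?X" and B: "B \<in> (\<lambda>U. U - H) ` ?X" and "A \<noteq> B"
    from A obtain U where U: "U \<in> ?X" "A = U - H" by (rule imageE)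
    from B obtain U' where U': "U' \<in> ?X" "B = U' - H" by (rule imageE)
    show "A \<inter> B = {}"
    proof (rule ccontr)
      assume "A \<inter> B \<noteq> {}"
      then obtain x where "x \<in> U - H" "x \<in> U' - H" using U(2) U'(2) by auto
      then have "U = U'" using uniq[OF U(1)] uniq[OF U'(1)] by metis
      with \<open>A \<noteq> B\<close> U U' show False by simp
    qed
  qed
  also have "\<dots> = card V - card H"
    unfolding cover using H V finV by (simp add: card_Diff_subset)
  also have "\<dots> = (?q - 1) * ?q ^ dim H"
    using H V finV by (simp add: card_subspace algebra_simps)
  finally have "(?q - 1) * ?q ^ dim W * card ?X = (?q - 1) * ?q ^ dim H"
    by (simp add: card_image[OF inj])
  moreover have "dim W \<le> dim H"
    using W finV[OF H(2)] by (intro dim_mono_finite) (auto intro: span_base)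
  then have "?q ^ dim H = ?q ^ dim W * ?q ^ (dim H - dim W)" by (simp flip: power_add)
  ultimately show ?thesis using q1 by simp
qed

end

text \<open>Induction on the codimension of \<open>W\<close> in \<open>V\<close>. Given a hyperplane
  \<open>H\<close> of \<open>V\<close> that contains \<open>W\<close>, the subspaces inside
  \<open>H\<close> account for the first term of the Pascal rule, and the others, sorted by their
  intersection with \<open>H\<close>, for the second.\<close>

lemma card_subspace_interval:
  assumes q: "finite (UNIV :: 'a set)"
    and "subspace W" "subspace V" "finite V" "W \<subseteq> V" "dim V = dim W + n"
  shows "card {U. subspace U \<and> W \<subseteq> U \<and> U \<subseteq> V \<and> dim U = dim W + k} = gauss_binomial (CARD('a)) n k"
  using assms(2-)
proof (induction n arbitrary: V k)
  case 0
  then have WV: "W = V" by (intro subspace_eqI_dim) auto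
  show ?case
  proof (cases k)
    case k: 0
    have "{U. subspace U \<and> W \<subseteq> U \<and> U \<subseteq> V \<and> dim U = dim W + k} = {V}"
      unfolding WV k using 0 by (intro equalityI subsetI; clarsimp)
    then show ?thesis using k by simp
  next
    case k: (Suc j)
    have "{U. subspace U \<and> W \<subseteq> U \<and> U \<subseteq> V \<and> dim U = dim W + k} = {}"
      unfolding WV k by (auto dest: antisym)
    then show ?thesis by (simp only: k card.empty gauss_binomial.simps)
  qed
next
  case (Suc n)
  note V = Suc.prems
  have "W \<subset> V" using V by auto
  then obtain H where H: "subspace H" "W \<subseteq> H" "H \<subseteq> V" "dim V = Suc (dim H)"
    using exists_hyperplane[of W V] V by metis
  have finH: "finite H" using H V finite_subset by blast
  have dH: "dim H = dim W + n" using H V by simp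
  have IH: "card {U. subspace U \<and> W \<subseteq> U \<and> U \<subseteq> H \<and> dim U = dim W + k} = gauss_binomial (CARD('a)) n k" for k
    using Suc.IH[of H k] H finH V dH by auto
  note hyp = V(2,3) H(1,3,4)
  show ?case
  proof (cases k)
    case 0
    have "U = W" if "subspace U" "W \<subseteq> U" "U \<subseteq> V" "dim U = dim W" for U
      using that V finite_subset[of U V] by (intro subspace_eqI_dim[symmetric]) auto
    then have "{U. subspace U \<and> W \<subseteq> U \<and> U \<subseteq> V \<and> dim U = dim W + k} = {W}"
      using 0 V by auto
    then show ?thesis using 0 by simp
  next
    case k: (Suc j)
    let ?A = "{U. subspace U \<and> W \<subseteq> U \<and> U \<subseteq> H \<and> dim U = dim W + k}"
    let ?B = "{U. subspace U \<and> W \<subseteq> U \<and> U \<subseteq> H \<and> dim U = dim W + j}"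
    let ?X = "\<lambda>T. {U. subspace U \<and> U \<subseteq> V \<and> \<not> U \<subseteq> H \<and> U \<inter> H = T}"
    have fin: "finite ?A" "finite ?B"
      by (rule finite_subset[of _ "Pow H"]; use finH in auto)+
    have finX: "finite (?X T)" for T by (rule finite_subset[of _ "Pow V"]) (use V in auto)
    have "{U. subspace U \<and> W \<subseteq> U \<and> U \<subseteq> V \<and> dim U = dim W + k} = ?A \<union> (\<Union>T\<in>?B. ?X T)"
    proof (intro set_eqI iffI)
      fix U assume U: "U \<in> {U. subspace U \<and> W \<subseteq> U \<and> U \<subseteq> V \<and> dim U = dim W + k}"
      show "U \<in> ?A \<union> (\<Union>T\<in>?B. ?X T)"
      proof (cases "U \<subseteq> H")
        case False
        then have "dim U = Suc (dim (U \<inter> H))"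
          using U by (intro dim_Int_hyperplane[OF hyp]) auto
        then have "U \<inter> H \<in> ?B" using U H k by (auto simp: subspace_inter)
        then show ?thesis using False U by auto
      qed (use U in auto)
    next
      fix U assume "U \<in> ?A \<union> (\<Union>T\<in>?B. ?X T)"
      then show "U \<in> {U. subspace U \<and> W \<subseteq> U \<and> U \<subseteq> V \<and> dim U = dim W + k}"
      proof
        assume "U \<in> (\<Union>T\<in>?B. ?X T)"
        then have U: "subspace U" "U \<subseteq> V" "\<not> U \<subseteq> H" "U \<inter> H \<in> ?B" by auto
        then show ?thesis using dim_Int_hyperplane[OF hyp U(1-3)] k by auto
      qed (use H in auto)
    qed
    moreover have "card (?A \<union> (\<Union>T\<in>?B. ?X T)) = card ?A + card (\<Union>T\<in>?B. ?X T)"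
      using fin finX by (intro card_Un_disjoint) auto
    moreover have "card (\<Union>T\<in>?B. ?X T) = (\<Sum>T\<in>?B. card (?X T))"
      using fin finX by (intro card_UN_disjoint) auto
    \<comment> \<open>\<open>T\<close> has dimension \<open>dim W + j\<close> and \<open>H\<close>
      has dimension \<open>dim W + n\<close>, whence the exponent \<open>n - j\<close>.\<close>
    moreover have "(\<Sum>T\<in>?B. card (?X T)) = (\<Sum>T\<in>?B. CARD('a) ^ (n - j))"
    proof (intro sum.cong refl)
      fix T assume T: "T \<in> ?B"
      then show "card (?X T) = CARD('a) ^ (n - j)"
        using card_subspaces_meeting_hyperplane[OF hyp, of T] q dH by simp
    qed
    ultimately show ?thesis using IH[of k] IH[of j] k by simp
  qed
qed

corollary card_subspace_interval_symmetric:
  assumes "finite (UNIV :: 'a set)"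
    and "subspace W" "subspace V" "finite V" "W \<subseteq> V" "dim V = dim W + n" "k \<le> n"
  shows "card {U. subspace U \<and> W \<subseteq> U \<and> U \<subseteq> V \<and> dim U = dim W + (n - k)} =
    card {U. subspace U \<and> W \<subseteq> U \<and> U \<subseteq> V \<and> dim U = dim W + k}"
  using card_subspace_interval[OF assms(1-6)] gauss_binomial_symmetric[OF assms(7)] by simp

end

subsection \<open>Contractions and Kazhdan--Lusztig polynomials\<close>

context matroid
begin

text \<open>The two records are equal and not merely isomorphic, because independence in a
  contraction is defined through ranks instead of a chosen basis.\<close>

lemma contract_contract:
  assumes "F \<subseteq> ground M" "G \<subseteq> ground M - F"
  shows "contract (contract M F) G = contract M (F \<union> G)"
proof -
  have "rank_of (contract M F) (I \<union> G) = card I + rank_of (contract M F) G \<longleftrightarrow>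
      rank_of M (I \<union> (F \<union> G)) = card I + rank_of M (F \<union> G)"
    if "I \<subseteq> ground M - F" for I
    using rank_contract[of "I \<union> G" F] rank_contract[of G F] that assms
    by (simp add: Un_ac) linarith
  then have "indep (contract (contract M F) G) = indep (contract M (F \<union> G))"
    by (auto simp: contract_def)
  then show ?thesis
    by (intro pre_matroid.equality) (auto simp: contract_def)
qed

lemma flats_contract_iff:
  assumes "F \<subseteq> ground M" "G \<subseteq> ground M - F"
  shows "G \<in> flats (contract M F) \<longleftrightarrow> F \<union> G \<in> flats M"
proof -
  have *: "rank_of (contract M F) G < rank_of (contract M F) (insert x G) \<longleftrightarrow>
      rank_of M (F \<union> G) < rank_of M (insert x (F \<union> G))" if "x \<in> ground M - F" for x
    using rank_contract[of G F] rank_contract[of "insert x G" F] that assms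
    by (simp add: Un_ac) linarith
  have "ground (contract M F) = ground M - F" by (simp add: contract_def)
  then show ?thesis
    using * assms by (auto simp: flats_def)
qed

text \<open>Union with \<open>F\<close> is a bijection from the flats of the contraction to the
  flats of \<open>M\<close> above \<open>F\<close>, and it raises the rank by
  \<open>rank_of M F\<close>.\<close>

lemma Z_poly_contract:
  assumes F: "F \<in> flats M"
  shows "Z_poly P (contract M F) =
    (\<Sum>G | G \<in> flats M \<and> F \<subseteq> G. monom 1 (rank_of M G - rank_of M F) * P (contract M G))"
  unfolding Z_poly_def
proof (rule sum.reindex_bij_witness[of _ "\<lambda>G. G - F" "\<lambda>G. F \<union> G"])
  have FM: "F \<subseteq> ground M" using F flat_subset by blast
  fix G assume G: "G \<in> flats (contract M F)"
  then have sub: "G \<subseteq> ground M - F" by (auto simp: flats_def contract_def)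
  show "F \<union> G - F = G" using sub by auto
  show "F \<union> G \<in> {G. G \<in> flats M \<and> F \<subseteq> G}"
    using G flats_contract_iff[OF FM sub] by auto
  show "monom 1 (rank_of M (F \<union> G) - rank_of M F) * P (contract M (F \<union> G)) =
      monom 1 (rank_of (contract M F) G) * P (contract (contract M F) G)"
    using rank_contract[OF sub] contract_contract[OF FM sub] by (metis Un_commute add_diff_cancel_right')
next
  fix G assume G: "G \<in> {G. G \<in> flats M \<and> F \<subseteq> G}"
  then have sub: "F \<subseteq> ground M" "G - F \<subseteq> ground M - F" using flat_subset by blast+
  have e: "F \<union> (G - F) = G" using G by auto
  show "F \<union> (G - F) = G" by (fact e)
  show "G - F \<in> flats (contract M F)" using flats_contract_iff[OF sub] G unfolding e by auto
qed

text \<open>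
  Contractions of contractions are again contractions of \<open>M\<close>, so the Kazhdan--Lusztig
  recursion takes place inside its lattice of flats, with \<open>p F\<close> in the role of
  \<open>kl_poly (contract M F)\<close>.
\<close>

theorem kl_poly_eqI:
  fixes p :: "'a set \<Rightarrow> int poly"
  assumes loopless: "loopless M"
    and top: "\<And>F. F \<in> flats M \<Longrightarrow> rank_of M F = rk M \<Longrightarrow> p F = 1"
    and deg: "\<And>F. F \<in> flats M \<Longrightarrow> rank_of M F < rk M \<Longrightarrow> 2 * degree (p F) < rk M - rank_of M F"
    and pal: "\<And>F i. F \<in> flats M \<Longrightarrow> i \<le> rk M - rank_of M F \<Longrightarrow>
      coeff (\<Sum>G | G \<in> flats M \<and> F \<subseteq> G. monom 1 (rank_of M G - rank_of M F) * p G)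
        (rk M - rank_of M F - i) =
      coeff (\<Sum>G | G \<in> flats M \<and> F \<subseteq> G. monom 1 (rank_of M G - rank_of M F) * p G) i"
  shows "kl_poly M = p {}"
proof -
  define k where "k F = kl_rec (contract M F)" for F
  \<comment> \<open>The induction on the corank needs the claim for all flats, since the recursion
    at \<open>F\<close> involves every flat above \<open>F\<close>.\<close>
  have "k F = p F" if "F \<in> flats M" for F
    using that
  proof (induction "rk M - rank_of M F" arbitrary: F rule: less_induct)
    case less
    note F = less.prems
    have FM: "F \<subseteq> ground M" using F flat_subset by blast
    define r where "r = rk M - rank_of M F"
    have r: "rk (contract M F) = r" using rk_contract[OF FM] by (simp add: r_def)
    have rF: "rank_of M F \<le> rk M" using rk_contract[OF FM] by simp
    have kl: "r = 0 \<Longrightarrow> k F = 1" "r > 0 \<Longrightarrow> 2 * degree (k F) < r"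
        "degree (Z_poly kl_rec (contract M F)) = r"
        "reflect_poly (Z_poly kl_rec (contract M F)) = Z_poly kl_rec (contract M F)"
      using kl_family_exists matroid_contract[of F] loopless_contract[OF F]
      unfolding kl_family_def k_def r[symmetric] by blast+
    show ?case
    proof (cases "r = 0")
      case True
      then have "rank_of M F = rk M" using rF by (simp add: r_def)
      then show ?thesis using kl(1) True top F by simp
    next
      case False
      let ?S = "{G. G \<in> flats M \<and> F \<subseteq> G}"
      define Z where "Z f = (\<Sum>G\<in>?S. monom 1 (rank_of M G - rank_of M F) * f G)"
        for f :: "'a set \<Rightarrow> int poly"
      \<comment> \<open>The contribution of the flats strictly above \<open>F\<close>; by the
        induction hypothesis it is the same for \<open>k\<close> and \<open>p\<close>.\<close>
      define R where "R = (\<Sum>G\<in>?S - {F}. monom 1 (rank_of M G - rank_of M F) * p G)"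
      have finS: "finite ?S" using finite_flats by simp
      have split: "Z f = f F + (\<Sum>G\<in>?S - {F}. monom 1 (rank_of M G - rank_of M F) * f G)" for f
        unfolding Z_def using finS F
        by (subst sum.remove[of _ F]) (auto simp: monom_0 one_pCons[symmetric])
      have IH: "k G = p G" if G: "G \<in> ?S - {F}" for G
      proof (rule less.hyps)
        have GM: "G \<subseteq> ground M" using G flat_subset by auto
        obtain x where x: "x \<in> G - F" using G by auto
        have "rank_of M F < rank_of M (insert x F)" using F x GM by (auto simp: flats_def)
        also have "\<dots> \<le> rank_of M G"
        proof -
          obtain B where "B \<in> indep M" "B \<subseteq> insert x F" "card B = rank_of M (insert x F)"
            by (rule obtain_basis)
          then show ?thesis using card_le_rank[of B G] x G by auto
        qed
        finally have "rank_of M F < rank_of M G" .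
        moreover have "rank_of M G \<le> rk M" using rk_contract[OF GM] by simp
        ultimately show "rk M - rank_of M G < rk M - rank_of M F" by simp
      qed (use G in auto)
      have Zk: "Z k = k F + R"
        unfolding split R_def using IH by (intro arg_cong2[where f = "(+)"] sum.cong) auto
      have Zp: "Z p = p F + R" unfolding split R_def ..
      have "Z_poly kl_rec (contract M F) = Z k"
        unfolding Z_poly_contract[OF F] Z_def k_def ..
      with kl have palk: "coeff (Z k) (r - i) = coeff (Z k) i" if "i \<le> r" for i
        using coeff_reflect_poly[of "Z k" i] that by simp
      have palp: "coeff (Z p) (r - i) = coeff (Z p) i" if "i \<le> r" for i
        using pal[OF F] that unfolding r_def Z_def by simp
      have degk: "2 * degree (k F) < r" using kl False by simp
      have degp: "2 * degree (p F) < r" using deg[OF F] False rF by (simp add: r_def)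
      \<comment> \<open>For \<open>2 * i < r\<close> only \<open>R\<close> contributes in degree
        \<open>r - i\<close>, so the symmetry determines coefficient \<open>i\<close> of both
        \<open>k F\<close> and \<open>p F\<close> from \<open>R\<close>. In all other degrees both
        vanish.\<close>
      show ?thesis
      proof (rule poly_eqI)
        fix i
        show "coeff (k F) i = coeff (p F) i"
        proof (cases "2 * i < r")
          case True
          then have "coeff (k F) (r - i) = 0" "coeff (p F) (r - i) = 0"
            using degk degp by (auto intro!: coeff_eq_0)
          then show ?thesis using palk[of i] palp[of i] True by (simp add: Zk Zp)
        next
          case False
          then have "coeff (k F) i = 0" "coeff (p F) i = 0"
            using degk degp by (auto intro!: coeff_eq_0)
          then show ?thesis by simp
        qed
      qed
    qed
  qed
  from this[OF empty_flat[OF loopless]] show ?thesis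
    using kl_poly_eq[OF kl_family_exists matroid_axioms loopless] by (simp add: k_def contract_empty)
qed

end

subsection \<open>Complements of small sets of vectors\<close>

lemma coeff_sum_monom:
  assumes "finite S"
  shows "coeff (\<Sum>x\<in>S. monom 1 (f x)) i = of_nat (card {x \<in> S. f x = i})"
proof -
  have "coeff (\<Sum>x\<in>S. monom 1 (f x)) i = (\<Sum>x\<in>S. if f x = i then 1 else 0)"
    by (simp add: coeff_sum)
  also have "\<dots> = of_nat (card {x \<in> S. f x = i})"
    using assms by (simp add: sum.If_cases Int_def)
  finally show ?thesis .
qed

text \<open>Labels and vectors have separate types, so that natural numbers can name the vectors.
  Injectivity makes repeated vectors dependent, as in \<open>representable_over\<close>.\<close>

definition vector_matroid ::
    "('f::field \<Rightarrow> 'b::ab_group_add \<Rightarrow> 'b) \<Rightarrow> 'c set \<Rightarrow> ('c \<Rightarrow> 'b) \<Rightarrow> 'c pre_matroid" where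
  "vector_matroid scale E v = \<lparr>ground = E,
     indep = {I. I \<subseteq> E \<and> inj_on v I \<and> \<not> module.dependent scale (v ` I)}\<rparr>"

lemma ground_vector_matroid [simp]: "ground (vector_matroid scale E v) = E"
  by (simp add: vector_matroid_def)

context vector_space
begin

text \<open>For \<open>x\<close> in \<open>U - W\<close> and \<open>y\<close> in \<open>W\<close>,
  the sum \<open>x + y\<close> is again outside \<open>W\<close>, so \<open>y = (x + y) - x\<close>
  is a difference of two vectors of \<open>D\<close>. This is what bounds dimensions in the degree
  estimate.\<close>

lemma subset_span_if_Diff_subset:
  assumes "subspace U" "subspace W" "W \<subset> U" "U - W \<subseteq> D"
  shows "U \<subseteq> span D"
proof
  obtain x where x: "x \<in> U" "x \<notin> W" using assms by auto
  fix y assume y: "y \<in> U"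
  show "y \<in> span D"
  proof (cases "y \<in> W")
    case True
    then have "x + y \<in> U - W"
      using assms x y subspace_diff[of W "x + y" y] by (auto intro: subspace_add)
    then have "x + y \<in> D" "x \<in> D" using assms x by auto
    then show ?thesis using span_diff[of "x + y" D x] by (simp add: span_base)
  qed (use assms y in \<open>auto intro: span_base\<close>)
qed

section \<open>Independence, rank and flats of vector matroids\<close>

lemma indep_vector_matroid:
  "I \<in> indep (vector_matroid scale E v) \<longleftrightarrow> I \<subseteq> E \<and> inj_on v I \<and> independent (v ` I)"
  by (simp add: vector_matroid_def)

lemma matroid_vector_matroid:
  assumes "finite E"
  shows "matroid (vector_matroid scale E v)"
proof
  fix I J
  assume I: "I \<in> indep (vector_matroid scale E v)" and J: "J \<in> indep (vector_matroid scale E v)"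
    and less: "card I < card J"
  have fin: "finite I" "finite J"
    using I J assms finite_subset by (auto simp: indep_vector_matroid)
  have "\<not> v ` J \<subseteq> span (v ` I)"
  proof
    assume "v ` J \<subseteq> span (v ` I)"
    then have "card (v ` J) \<le> card (v ` I)"
      using J fin independent_span_bound[of "v ` I" "v ` J"] by (auto simp: indep_vector_matroid)
    then show False using less I J by (simp add: indep_vector_matroid card_image)
  qed
  then obtain x where x: "x \<in> J" "v x \<notin> span (v ` I)" by auto
  then have "v x \<notin> v ` I" using span_base by blast
  with x I J have "insert x I \<in> indep (vector_matroid scale E v)"
    by (auto simp: indep_vector_matroid independent_insertI)
  then show "\<exists>x\<in>J - I. insert x I \<in> indep (vector_matroid scale E v)"
    using x \<open>v x \<notin> v ` I\<close> by blast
qed (use assms in \<open>auto simp: indep_vector_matroid independent_empty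
      intro: inj_on_subset dest: dependent_mono[OF _ image_mono]\<close>)

lemma rank_vector_matroid:
  assumes "finite E" "X \<subseteq> E"
  shows "rank_of (vector_matroid scale E v) X = dim (v ` X)"
proof (rule antisym)
  interpret M: matroid "vector_matroid scale E v" by (rule matroid_vector_matroid[OF assms(1)])
  have finX: "finite X" using assms finite_subset by blast
  obtain I where I: "I \<in> indep (vector_matroid scale E v)" "I \<subseteq> X"
      "card I = rank_of (vector_matroid scale E v) X"
    by (rule M.obtain_basis)
  have "card I = dim (v ` I)"
    using I by (simp add: indep_vector_matroid card_image dim_eq_card_independent)
  also have "\<dots> \<le> dim (v ` X)"
    using finX I by (intro dim_mono_finite) (auto intro: span_base)
  finally show "rank_of (vector_matroid scale E v) X \<le> dim (v ` X)" using I by simp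
  obtain B where B: "B \<subseteq> v ` X" "independent B" "v ` X \<subseteq> span B" "card B = dim (v ` X)"
    by (rule basis_exists)
  then obtain J where J: "J \<subseteq> X" "inj_on v J" "B = v ` J" by (auto simp: subset_image_inj)
  then have "J \<in> indep (vector_matroid scale E v)" using B assms by (auto simp: indep_vector_matroid)
  from M.card_le_rank[OF this \<open>J \<subseteq> X\<close>] show "dim (v ` X) \<le> rank_of (vector_matroid scale E v) X"
    using B J by (simp add: card_image)
qed

lemma flats_vector_matroid:
  assumes "finite E"
  shows "F \<in> flats (vector_matroid scale E v) \<longleftrightarrow> F \<subseteq> E \<and> (\<forall>x\<in>E - F. v x \<notin> span (v ` F))"
proof -
  have "rank_of (vector_matroid scale E v) F < rank_of (vector_matroid scale E v) (insert x F) \<longleftrightarrow>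
      v x \<notin> span (v ` F)" if "F \<subseteq> E" "x \<in> E" for x
  proof (cases "v x \<in> span (v ` F)")
    case True
    then have "dim (insert (v x) (v ` F)) = dim (v ` F)" by (metis dim_span span_redundant)
    then show ?thesis using True that assms by (simp add: rank_vector_matroid)
  next
    case False
    moreover have "finite (v ` F)" using that assms finite_subset by blast
    ultimately show ?thesis using that assms by (simp add: rank_vector_matroid dim_insert_finite)
  qed
  then show ?thesis by (auto simp: flats_def)
qed

theorem kl_poly_complement:
  assumes q: "finite (UNIV :: 'a set)"
    and V: "subspace V" "finite V"
    and D: "D \<subseteq> V" "0 \<in> D" "2 * dim D < dim V"
    and v: "bij_betw v (E :: 'c set) (V - D)"
  shows "loopless (vector_matroid scale E v)"
    and "coeff (kl_poly (vector_matroid scale E v)) i = int (card {U. subspace U \<and> U \<subseteq> D \<and> dim U = i})"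
proof -
  let ?M = "vector_matroid scale E v"
  have vE: "v ` E = V - D" and inj: "inj_on v E" using v by (auto simp: bij_betw_def)
  have finE: "finite E" using v V bij_betw_finite by blast
  interpret M: matroid ?M by (rule matroid_vector_matroid[OF finE])
  note rank = rank_vector_matroid[OF finE] and flat = flats_vector_matroid[OF finE]
  show loopless: "loopless ?M"
    \<comment> \<open>Having \<open>0\<close> in \<open>D\<close> keeps the zero vector out of the
      ground set.\<close>
    unfolding loopless_def using vE D by (auto simp: indep_vector_matroid)
  have finV: "finite A" if "A \<subseteq> V" for A using that V finite_subset by blast
  have dim_V: "dim U \<le> dim V" if "U \<subseteq> V" for U
    using that V by (intro dim_mono_finite) (auto intro: span_base)
  have small: "dim U \<le> dim D" if "subspace U" "subspace W" "W \<subset> U" "U - W \<subseteq> D" for U W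
    using subset_span_if_Diff_subset[OF that] finV[OF D(1)] by (rule dim_mono_finite[rotated])
  define S where "S = {U. subspace U \<and> U \<subseteq> V}"
  have finS: "finite S" unfolding S_def by (rule finite_subset[of _ "Pow V"]) (use V in auto)
  \<comment> \<open>The flat, as a set of labels, in which \<open>U\<close> meets
    \<open>V - D\<close>.\<close>
  define Fl where "Fl U = {x \<in> E. v x \<in> U}" for U
  have vF_V: "span (v ` F) \<subseteq> V" if "F \<subseteq> E" for F
    using that vE V by (intro span_minimal) auto
  have Fl_flat: "Fl U \<in> flats ?M" if "U \<in> S" for U
  proof -
    have "span (v ` Fl U) \<subseteq> U" using that by (intro span_minimal) (auto simp: Fl_def S_def)
    then show ?thesis by (auto simp: flat Fl_def)
  qed
  have Diff_Fl: "U - span (v ` Fl U) \<subseteq> D" if "U \<in> S" for U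
  proof
    fix y assume y: "y \<in> U - span (v ` Fl U)"
    show "y \<in> D"
    proof (rule ccontr)
      assume "y \<notin> D"
      then have "y \<in> v ` E" using y that vE by (auto simp: S_def)
      then have "y \<in> v ` Fl U" using y by (auto simp: Fl_def)
      then show False using y span_base by blast
    qed
  qed
  \<comment> \<open>If \<open>V - D\<close> did not span \<open>V\<close>, then \<open>small\<close>
    would apply to \<open>V\<close> itself.\<close>
  have span_E: "span (v ` E) = V"
  proof (rule ccontr)
    assume "span (v ` E) \<noteq> V"
    then have "span (v ` E) \<subset> V" using vF_V[of E] by auto
    moreover have "V - span (v ` E) \<subseteq> D" unfolding vE by (auto intro: span_base)
    ultimately have "dim V \<le> dim D" using V by (intro small) auto
    with D show False by simp
  qed
  have rk: "rk ?M = dim V" using rank[of E] span_E dim_span[of "v ` E"] by simp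
  \<comment> \<open>The truncated subtraction is exact, because \<open>U\<close> contains the
    vectors labelled by \<open>F\<close>.\<close>
  define p :: "'c set \<Rightarrow> int poly"
    where "p F = (\<Sum>U | U \<in> S \<and> Fl U = F. monom 1 (dim U - dim (v ` F)))"
    for F
  have "kl_poly ?M = p {}"
  proof (rule M.kl_poly_eqI[OF loopless, unfolded rk])
    fix F assume F: "F \<in> flats ?M"
    then have FE: "F \<subseteq> E" and Ff: "\<And>x. x \<in> E \<Longrightarrow> v x \<in> span (v ` F) \<Longrightarrow> x \<in> F"
      unfolding flat by auto
    have rF: "rank_of ?M F = dim (v ` F)" using rank FE by blast
    let ?W = "span (v ` F)"
    have W: "?W \<in> S" "Fl ?W = F"
      using vF_V[OF FE] Ff FE by (auto simp: S_def Fl_def intro: span_base)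
    have W_sub: "?W \<subseteq> U" if "U \<in> S" "F \<subseteq> Fl U" for U
      using that by (intro span_minimal) (auto simp: S_def Fl_def)
    show "p F = 1" if r: "rank_of ?M F = dim V"
    proof -
      have WV: "?W = V"
        using W r V rF by (intro subspace_eqI_dim) (auto simp: S_def)
      have "{U. U \<in> S \<and> Fl U = F} = {V}"
        using W W_sub unfolding WV by (auto simp: S_def)
      then show ?thesis using r rF by (simp add: p_def monom_0 one_pCons[symmetric])
    qed
    show "2 * degree (p F) < dim V - rank_of ?M F" if r: "rank_of ?M F < dim V"
    proof -
      \<comment> \<open>The span of \<open>F\<close> contributes degree \<open>0\<close>. Any other
        \<open>U\<close> satisfies \<open>2 * dim U < dim V\<close> by \<open>small\<close>; passing
        to the contraction takes the rank of \<open>F\<close> twice from the left but only once from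
        the right.\<close>
      have "degree (monom (1 :: int) (dim U - dim (v ` F))) \<le> (dim V - dim (v ` F) - 1) div 2"
        if U: "U \<in> {U. U \<in> S \<and> Fl U = F}" for U
      proof (cases "U = ?W")
        case False
        then have "dim U \<le> dim D"
          using U W_sub[of U] Diff_Fl[of U] by (intro small[of U ?W]) (auto simp: S_def)
        then have "2 * (dim U - dim (v ` F)) \<le> dim V - dim (v ` F) - 1" using D r rF by linarith
        then show ?thesis by (simp add: degree_monom_eq)
      qed (simp add: degree_monom_eq)
      then have "degree (p F) \<le> (dim V - dim (v ` F) - 1) div 2"
        unfolding p_def using finS by (intro degree_sum_le) auto
      then show ?thesis using r rF by linarith
    qed
    fix i assume i: "i \<le> dim V - rank_of ?M F"
    let ?n = "dim V - dim (v ` F)"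
    let ?T = "{U. U \<in> S \<and> F \<subseteq> Fl U}"
    let ?Z = "\<Sum>G | G \<in> flats ?M \<and> F \<subseteq> G. monom 1 (rank_of ?M G - rank_of ?M F) * p G"
    have "?Z = (\<Sum>G | G \<in> flats ?M \<and> F \<subseteq> G.
        \<Sum>U | U \<in> ?T \<and> Fl U = G. monom 1 (dim U - dim (v ` F)))"
    proof (intro sum.cong refl)
      fix G assume "G \<in> {G. G \<in> flats ?M \<and> F \<subseteq> G}"
      then have G: "G \<in> flats ?M" "F \<subseteq> G" "G \<subseteq> E" unfolding flat by auto
      have rG: "rank_of ?M G = dim (v ` G)" using rank G by blast
      have fin: "finite (v ` G)" using G finE finite_subset by blast
      have "monom 1 (rank_of ?M G - rank_of ?M F) * p G =
          (\<Sum>U | U \<in> S \<and> Fl U = G.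
            monom 1 (dim (v ` G) - dim (v ` F) + (dim U - dim (v ` G))))"
        unfolding p_def rG rF by (simp add: sum_distrib_left mult_monom)
      also have "\<dots> = (\<Sum>U | U \<in> ?T \<and> Fl U = G. monom 1 (dim U - dim (v ` F)))"
      proof (intro sum.cong)
        show "{U. U \<in> S \<and> Fl U = G} = {U. U \<in> ?T \<and> Fl U = G}" using G by auto
        fix U assume U: "U \<in> {U. U \<in> ?T \<and> Fl U = G}"
        then have "v ` G \<subseteq> U" by (auto simp: Fl_def)
        then have "dim (v ` G) \<le> dim U"
          using U finV[of U] by (intro dim_mono_finite) (auto simp: S_def intro: span_base)
        moreover have "dim (v ` F) \<le> dim (v ` G)"
          using fin G by (intro dim_mono_finite) (auto intro: span_base)
        ultimately show "monom 1 (dim (v ` G) - dim (v ` F) + (dim U - dim (v ` G))) =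
            monom (1 :: int) (dim U - dim (v ` F))" by simp
      qed
      finally show "monom 1 (rank_of ?M G - rank_of ?M F) * p G =
          (\<Sum>U | U \<in> ?T \<and> Fl U = G. monom 1 (dim U - dim (v ` F)))" .
    qed
    \<comment> \<open>Every \<open>U\<close> belongs to exactly one flat, \<open>Fl U\<close>, so
      the double sum collapses.\<close>
    also have "\<dots> = (\<Sum>U\<in>?T. monom 1 (dim U - dim (v ` F)))"
      using finS M.finite_flats Fl_flat by (intro sum.group) auto
    finally have Z: "?Z = (\<Sum>U\<in>?T. monom 1 (dim U - dim (v ` F)))" .
    have coeff_Z: "coeff ?Z j =
        int (card {U. subspace U \<and> ?W \<subseteq> U \<and> U \<subseteq> V \<and> dim U = dim ?W + j})" for j
    proof -
      have "{U \<in> ?T. dim U - dim (v ` F) = j} =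
          {U. subspace U \<and> ?W \<subseteq> U \<and> U \<subseteq> V \<and> dim U = dim ?W + j}"
      proof (intro Collect_cong)
        fix U
        have "F \<subseteq> Fl U \<longleftrightarrow> ?W \<subseteq> U" if "U \<in> S"
          using W_sub[OF that] FE by (auto simp: Fl_def intro: span_base)
        moreover have "dim ?W \<le> dim U" if "?W \<subseteq> U" "U \<in> S"
          using that finV[of U] span_superset by (intro dim_mono_finite) (auto simp: S_def)
        ultimately show "U \<in> ?T \<and> dim U - dim (v ` F) = j \<longleftrightarrow>
            subspace U \<and> ?W \<subseteq> U \<and> U \<subseteq> V \<and> dim U = dim ?W + j"
          by (auto simp: S_def)
      qed
      then show ?thesis unfolding Z using finS by (simp add: coeff_sum_monom)
    qed
    have "dim V = dim ?W + ?n" using dim_V[OF vF_V[OF FE]] by simp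
    from card_subspace_interval_symmetric[OF q subspace_span V vF_V[OF FE] this]
    show "coeff ?Z (dim V - rank_of ?M F - i) = coeff ?Z i"
      using i unfolding coeff_Z unfolding rF by simp
  qed
  also have "p {} = (\<Sum>U | U \<in> S \<and> Fl U = {}. monom 1 (dim U))"
    unfolding p_def using dim_eq_card_independent[OF independent_empty] by simp
  also have "coeff \<dots> i = int (card {U \<in> {U. U \<in> S \<and> Fl U = {}}. dim U = i})"
    using finS by (subst coeff_sum_monom) auto
  \<comment> \<open>\<open>Fl U\<close> is empty exactly if \<open>U\<close> avoids
    \<open>V - D\<close>.\<close>
  also have "{U \<in> {U. U \<in> S \<and> Fl U = {}}. dim U = i} = {U. subspace U \<and> U \<subseteq> D \<and> dim U = i}"
  proof (intro Collect_cong)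
    fix U
    have "Fl U = {} \<longleftrightarrow> U \<inter> v ` E = {}" by (auto simp: Fl_def)
    then show "U \<in> {U. U \<in> S \<and> Fl U = {}} \<and> dim U = i \<longleftrightarrow> subspace U \<and> U \<subseteq> D \<and> dim U = i"
      using D vE by (auto simp: S_def)
  qed
  finally show "coeff (kl_poly ?M) i = int (card {U. subspace U \<and> U \<subseteq> D \<and> dim U = i})" .
qed

end

subsection \<open>The counterexamples\<close>

text \<open>The encoding of the \<open>d\<close>-dimensional space that
  \<open>representable_over\<close> asks for.\<close>

definition coord_space :: "nat \<Rightarrow> (nat \<Rightarrow> 'f::field) set" where
  "coord_space d = {x. \<forall>i\<ge>d. x i = 0}"

definition unit_vec :: "nat \<Rightarrow> nat \<Rightarrow> 'f::field" where
  "unit_vec j = (\<lambda>i. if i = j then 1 else 0)"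

lemma subspace_coord_space: "fun_vec.subspace (coord_space d)"
  by (auto simp: fun_vec.subspace_def coord_space_def fun_scale_def)

lemma finite_coord_space: "finite (coord_space d :: (nat \<Rightarrow> 'f::{field,finite}) set)"
  by (rule finite_subset[OF _ finite_set_of_finite_funs[of "{..<d}" UNIV 0]])
    (auto simp: coord_space_def)

lemma coord_space_mono: "m \<le> n \<Longrightarrow> coord_space m \<subseteq> coord_space n"
  by (auto simp: coord_space_def)

lemma coord_space_0: "coord_space 0 = {0}"
  by (auto simp: coord_space_def fun_eq_iff)

lemma coord_space_Suc:
  fixes d :: nat
  defines "V \<equiv> coord_space d :: (nat \<Rightarrow> 'f::field) set"
  shows "coord_space (Suc d) = fun_vec.span (insert (unit_vec d) V)"
proof -
  have "x \<in> coord_space (Suc d) \<longleftrightarrow> (\<exists>c. x - fun_scale c (unit_vec d) \<in> V)" for x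
  proof
    assume "x \<in> coord_space (Suc d)"
    then have "x - fun_scale (x d) (unit_vec d) \<in> V"
      by (auto simp: V_def coord_space_def fun_scale_def unit_vec_def)
    then show "\<exists>c. x - fun_scale c (unit_vec d) \<in> V" ..
  qed (auto simp: V_def coord_space_def fun_scale_def unit_vec_def)
  then have "coord_space (Suc d) = {x. \<exists>c. x - fun_scale c (unit_vec d) \<in> V}"
    by auto
  moreover have "fun_vec.span V = V"
    by (simp add: V_def subspace_coord_space)
  ultimately show ?thesis by (simp only: fun_vec.span_insert)
qed

lemma dim_coord_space: "fun_vec.dim (coord_space d :: (nat \<Rightarrow> 'f::{field,finite}) set) = d"
proof (induction d)
  case 0
  show ?case
    using fun_vec.dim_span_eq_card_independent[of "{} :: (nat \<Rightarrow> 'f) set"]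
    by (simp add: coord_space_0 fun_vec.independent_empty)
next
  case (Suc d)
  have "unit_vec d \<notin> fun_vec.span (coord_space d :: (nat \<Rightarrow> 'f) set)"
    by (simp add: subspace_coord_space fun_vec.span_eq_iff[THEN iffD2])
      (simp add: coord_space_def unit_vec_def)
  then show ?case
    using Suc.IH
    by (simp add: coord_space_Suc fun_vec.dim_insert_finite finite_coord_space)
qed

text \<open>The union of the subspace of the first \<open>k\<close> coordinates and the next \<open>N\<close> coordinate axes.\<close>

definition space_with_axes :: "nat \<Rightarrow> nat \<Rightarrow> (nat \<Rightarrow> 'f::field) set" where
  "space_with_axes k N =
    {x \<in> coord_space (k + N). \<forall>j\<ge>k. x j \<noteq> 0 \<longrightarrow> (\<forall>i. i \<noteq> j \<longrightarrow> x i = 0)}"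

text \<open>Let \<open>x\<close> in \<open>U\<close> have a nonzero coordinate \<open>j\<close>
  beyond the first \<open>k\<close>. Vectors of \<open>U\<close> with nonzero coordinate
  \<open>j\<close> lie on axis \<open>j\<close>. If \<open>y\<close> in \<open>U\<close> has
  coordinate \<open>j\<close> zero, then \<open>x + y\<close> lies on that axis, and hence so does
  \<open>y\<close>. So \<open>U\<close> is inside one axis.\<close>

lemma dim_subspace_of_axes:
  assumes U: "fun_vec.subspace U" "U \<subseteq> space_with_axes k N"
    and not: "\<not> U \<subseteq> (coord_space k :: (nat \<Rightarrow> 'f::{field,finite}) set)"
  shows "fun_vec.dim U \<le> 1"
proof -
  obtain x j where x: "x \<in> U" "k \<le> j" "x j \<noteq> 0"
    using not by (auto simp: coord_space_def)
  have axis: "z i = 0" if "z \<in> U" "z j \<noteq> 0" "i \<noteq> j" for z i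
    using that U x(2) by (auto simp: space_with_axes_def)
  have "y i = 0" if y: "y \<in> U" and i: "i \<noteq> j" for y i
  proof (cases "y j = 0")
    case True
    have "x + y \<in> U" using U x y by (simp add: fun_vec.subspace_add)
    then have "(x + y) i = 0" using axis[of "x + y" i] x True i by simp
    moreover have "x i = 0" using axis x i by blast
    ultimately show ?thesis by simp
  qed (use axis y i in blast)
  then have "y = fun_scale (y j) (unit_vec j)" if "y \<in> U" for y
    using that by (auto simp: fun_scale_def unit_vec_def)
  then have "U \<subseteq> fun_vec.span {unit_vec j}"
    by (metis fun_vec.span_base fun_vec.span_scale insertI1 subsetI)
  then show ?thesis using fun_vec.dim_le_card[of U "{unit_vec j}"] by simp
qed

text \<open>From dimension \<open>2\<close> on the axes contribute nothing, and what remains is the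
  interval between the zero space and \<open>coord_space k\<close>.\<close>

lemma card_subspaces_of_axes:
  assumes "2 \<le> i"
  shows "card {U :: (nat \<Rightarrow> 'f::{field,finite}) set.
      fun_vec.subspace U \<and> U \<subseteq> space_with_axes k N \<and> fun_vec.dim U = i} =
    gauss_binomial (CARD('f)) k i"
proof -
  let ?zero = "{0} :: (nat \<Rightarrow> 'f) set"
  have zero: "fun_vec.dim ?zero = 0" using dim_coord_space[of 0] by (simp add: coord_space_0)
  have sub: "coord_space k \<subseteq> (space_with_axes k N :: (nat \<Rightarrow> 'f) set)"
    by (auto simp: space_with_axes_def coord_space_def)
  have "{U :: (nat \<Rightarrow> 'f) set. fun_vec.subspace U \<and> U \<subseteq> space_with_axes k N \<and> fun_vec.dim U = i} =
    {U. fun_vec.subspace U \<and> ?zero \<subseteq> U \<and> U \<subseteq> coord_space k \<and> fun_vec.dim U = fun_vec.dim ?zero + i}"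
    using dim_subspace_of_axes[of _ k N] sub assms zero
    by (fastforce dest: fun_vec.subspace_0)
  also have "card \<dots> = gauss_binomial (CARD('f)) k i"
    using zero fun_vec.subspace_0[OF subspace_coord_space]
    by (intro fun_vec.card_subspace_interval)
      (auto simp: subspace_coord_space finite_coord_space dim_coord_space)
  finally show ?thesis .
qed

text \<open>The \<open>N\<close> axes are distinct lines; this lower bound suffices to make the
  linear coefficient large.\<close>

lemma card_lines_of_axes:
  "N \<le> card {U :: (nat \<Rightarrow> 'f::{field,finite}) set.
    fun_vec.subspace U \<and> U \<subseteq> space_with_axes k N \<and> fun_vec.dim U = 1}"
    (is "_ \<le> card ?L")
proof -
  define l :: "nat \<Rightarrow> (nat \<Rightarrow> 'f) set" where "l j = fun_vec.span {unit_vec j}" for j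
  have l: "x \<in> l j \<longleftrightarrow> (\<exists>c. x = fun_scale c (unit_vec j))" for x j
    by (auto simp: l_def fun_vec.span_singleton)
  have nz: "unit_vec j \<noteq> (0 :: nat \<Rightarrow> 'f)" for j
    by (auto simp: unit_vec_def fun_eq_iff)
  have "card {k..<k + N} \<le> card ?L"
  proof (rule card_inj_on_le)
    show "inj_on l {k..<k + N}"
    proof (rule inj_onI)
      fix i j assume "l i = l j"
      then have "unit_vec i \<in> l j" unfolding l_def by (metis fun_vec.span_base insertI1)
      then obtain c where "unit_vec i = fun_scale c (unit_vec j :: nat \<Rightarrow> 'f)" by (auto simp: l)
      from fun_cong[OF this, of i] show "i = j"
        by (auto simp: fun_scale_def unit_vec_def split: if_splits)
    qed
    show "l ` {k..<k + N} \<subseteq> ?L"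
    proof clarify
      fix j assume j: "j \<in> {k..<k + N}"
      have "l j \<subseteq> space_with_axes k N"
        using j by (auto simp: l space_with_axes_def coord_space_def fun_scale_def unit_vec_def
            split: if_splits)
      moreover have "fun_vec.dim (l j) = 1"
        unfolding l_def using nz[of j] fun_vec.dim_span_eq_card_independent[of "{unit_vec j}"] by simp
      ultimately show "fun_vec.subspace (l j) \<and> l j \<subseteq> space_with_axes k N \<and> fun_vec.dim (l j) = 1"
        by (simp add: l_def)
    qed
    show "finite ?L"
      by (rule finite_subset[of _ "Pow (coord_space (k + N))"])
        (auto simp: finite_coord_space space_with_axes_def)
  qed
  then show ?thesis by simp
qed

lemma exists_matroid_kl_coeffs:
  fixes k N :: nat
  obtains M :: "nat pre_matroid" where
    "matroid M" "loopless M" "representable_over TYPE('f::{field,finite}) M"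
    "int N \<le> coeff (kl_poly M) 1"
    "\<And>i. 2 \<le> i \<Longrightarrow> coeff (kl_poly M) i = int (gauss_binomial (CARD('f)) k i)"
proof -
  \<comment> \<open>\<open>?D\<close> lies in a space of dimension \<open>k + N\<close>, so this is
    just above twice the bound on its dimension.\<close>
  let ?d = "2 * (k + N) + 1"
  let ?V = "coord_space ?d :: (nat \<Rightarrow> 'f) set"
  let ?D = "space_with_axes k N :: (nat \<Rightarrow> 'f) set"
  have DV': "?D \<subseteq> coord_space (k + N)" by (auto simp: space_with_axes_def)
  have DV: "?D \<subseteq> ?V" using DV' coord_space_mono[of "k + N" ?d] by auto
  have "fun_vec.dim ?D \<le> fun_vec.dim (coord_space (k + N) :: (nat \<Rightarrow> 'f) set)"
    using DV' finite_coord_space fun_vec.span_superset by (intro fun_vec.dim_mono_finite) auto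
  then have dim: "2 * fun_vec.dim ?D < fun_vec.dim ?V"
    by (simp only: dim_coord_space Suc_eq_plus1[symmetric] less_Suc_eq_le mult_le_mono2)
  have D0: "0 \<in> ?D" by (auto simp: space_with_axes_def coord_space_def)
  obtain v where v: "bij_betw v {0..<card (?V - ?D)} (?V - ?D)"
    using ex_bij_betw_nat_finite[of "?V - ?D"] finite_coord_space by blast
  let ?E = "{0..<card (?V - ?D)}"
  let ?M = "vector_matroid fun_scale ?E v"
  note kl = fun_vec.kl_poly_complement[OF finite_class.finite_UNIV subspace_coord_space
      finite_coord_space DV D0 dim v]
  show ?thesis
  proof (rule that[of ?M])
    show "matroid ?M" by (rule fun_vec.matroid_vector_matroid) simp
    show "loopless ?M" by (rule kl)
    have "v x \<in> ?V" if "x \<in> ?E" for x using v that by (auto simp: bij_betw_def)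
    then show "representable_over TYPE('f) ?M"
      unfolding representable_over_def
      by (intro exI[of _ ?d] exI[of _ v]) (auto simp: coord_space_def fun_vec.indep_vector_matroid)
    show "int N \<le> coeff (kl_poly ?M) 1"
      using card_lines_of_axes[of N k, where 'f = 'f] unfolding kl(2) by (simp only: of_nat_le_iff)
    show "coeff (kl_poly ?M) i = int (gauss_binomial (CARD('f)) k i)" if "2 \<le> i" for i
      using card_subspaces_of_axes[OF that, of k N, where 'f = 'f] unfolding kl(2) by (simp only:)
  qed
qed

text \<open>The list \<open>coeffs p\<close> ends at the degree, so a nonzero coefficient certifies
  that the list reaches its index.\<close>

lemma coeffs_nth_if_coeff_nonzero:
  assumes "coeff p n \<noteq> 0" "i \<le> n"
  shows "i < length (coeffs p)" "coeffs p ! i = coeff p i"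
proof -
  have "p \<noteq> 0" "n \<le> degree p" using assms by (auto intro: le_degree)
  then show "i < length (coeffs p)" "coeffs p ! i = coeff p i"
    using assms by (auto simp: length_coeffs coeffs_nth)
qed

text \<open>A peak at or after \<open>b\<close> contradicts the descent from \<open>a\<close>, and a
  peak at or before \<open>b\<close> contradicts the ascent to \<open>c\<close>.\<close>

lemma not_unimodal_if_valley:
  assumes "a < b" "b < c" "c < length xs" "xs ! b < xs ! a" "xs ! b < xs ! c"
  shows "\<not> unimodal xs"
proof
  assume "unimodal xs"
  then obtain k where k: "\<forall>i j. i \<le> j \<and> j \<le> k \<longrightarrow> xs ! i \<le> xs ! j"
      "\<forall>i j. k \<le> i \<and> i \<le> j \<and> j < length xs \<longrightarrow> xs ! j \<le> xs ! i"
    using assms by (auto simp: unimodal_def)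
  consider "b \<le> k" | "k \<le> b" by linarith
  then show False
  proof cases
    case 1
    then have "xs ! a \<le> xs ! b" using k(1) assms by simp
    then show False using assms by simp
  next
    case 2
    then have "xs ! c \<le> xs ! b" using k(2) assms by simp
    then show False using assms by simp
  qed
qed

text \<open>For a monic cubic, \<open>(coeff p 2)\<^sup>2 - 2 * coeff p 1\<close> is the sum of the squares of its zeros.\<close>

lemma not_all_zeros_real_cubic:
  assumes deg: "degree p = 3" and lead: "coeff p 3 = 1"
    and neg: "(coeff p 2)\<^sup>2 < 2 * coeff p 1"
  shows "\<not> all_zeros_real p"
proof
  assume real: "all_zeros_real p"
  let ?P = "map_poly of_int p :: complex poly"
  have degP: "degree ?P = 3" using deg by (simp add: degree_map_poly)
  have leadP: "lead_coeff ?P = 1" unfolding degP using lead by (simp add: coeff_map_poly)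
  obtain root where "smult (lead_coeff ?P) (\<Prod>i<degree ?P. [:-root i, 1:]) = ?P"
    by (rule complex_poly_decompose')
  then have P: "?P = [:-root 0, 1:] * [:-root 1, 1:] * [:-root 2, 1:]"
    unfolding leadP unfolding degP by (simp add: numeral_eq_Suc mult.commute mult.left_commute)
  have "root i \<in> \<real>" if "i < 3" for i :: nat
  proof -
    have "i = 0 \<or> i = 1 \<or> i = 2" using that by auto
    then have "poly ?P (root i) = 0" unfolding P by (elim disjE; simp only: poly_mult; simp)
    then show ?thesis using real by (simp add: all_zeros_real_def)
  qed
  from this[of 0] this[of 1] this[of 2] obtain x y z where
    r: "root 0 = complex_of_real x" "root 1 = complex_of_real y" "root 2 = complex_of_real z"
    by (auto elim!: Reals_cases)
  have "of_int (coeff p 2) = coeff ?P 2" "of_int (coeff p 1) = coeff ?P 1"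
    by (simp_all add: coeff_map_poly)
  \<comment> \<open>Vieta's formulas; as the zeros are real, they descend to identities of real
    numbers.\<close>
  then have "complex_of_real (of_int (coeff p 2)) = complex_of_real (- (x + y + z))"
    "complex_of_real (of_int (coeff p 1)) = complex_of_real (x * y + y * z + z * x)"
    unfolding P r by (simp_all add: numeral_eq_Suc algebra_simps)
  then have c: "real_of_int (coeff p 2) = - (x + y + z)"
    "real_of_int (coeff p 1) = x * y + y * z + z * x"
    by (simp_all only: of_real_eq_iff)
  have "real_of_int ((coeff p 2)\<^sup>2 - 2 * coeff p 1) = x\<^sup>2 + y\<^sup>2 + z\<^sup>2"
    by (simp add: c power2_eq_square algebra_simps del: One_nat_def)
  also have "\<dots> \<ge> 0" by simp
  finally show False using neg by linarith
qed

theorem corollary1p3: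
  shows "(\<exists>M :: nat pre_matroid. matroid M \<and> loopless M
            \<and> representable_over TYPE('f::{field,finite}) M
            \<and> \<not> unimodal (coeffs (kl_poly M)))
       \<and> (\<exists>M :: nat pre_matroid. matroid M \<and> loopless M
            \<and> \<not> log_concave_seq (coeffs (kl_poly M)))
       \<and> (\<exists>M :: nat pre_matroid. matroid M \<and> loopless M
            \<and> \<not> all_zeros_real (kl_poly M))"
proof -
  let ?q = "CARD('f)"
  \<comment> \<open>\<open>6\<close> is the least dimension with more subspaces of dimension
    \<open>3\<close> than of dimension \<open>2\<close>; the difference is a sum of powers of
    \<open>?q\<close>.\<close>
  have "gauss_binomial ?q 6 3 = gauss_binomial ?q 6 2 + (?q ^ 3 + ?q ^ 5 + ?q ^ 6 + ?q ^ 7 + ?q ^ 9)"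
    by (simp add: eval_nat_numeral algebra_simps)
  then have g: "gauss_binomial ?q 6 2 < gauss_binomial ?q 6 3" by simp
  obtain M :: "nat pre_matroid" where M: "matroid M" "loopless M" "representable_over TYPE('f) M"
    and M1: "int (gauss_binomial ?q 6 2 + 1) \<le> coeff (kl_poly M) 1"
    and Mi: "\<And>i. 2 \<le> i \<Longrightarrow> coeff (kl_poly M) i = int (gauss_binomial ?q 6 i)"
    by (rule exists_matroid_kl_coeffs[where 'f = 'f and k = 6 and N = "gauss_binomial ?q 6 2 + 1"])
      (rule that)
  let ?c = "coeffs (kl_poly M)"
  have "coeff (kl_poly M) 3 \<noteq> 0" using g Mi[of 3] by simp
  note nth = coeffs_nth_if_coeff_nonzero[OF this]
  have valley: "?c ! 2 < ?c ! 1" "?c ! 2 < ?c ! 3" "0 \<le> ?c ! 2" "3 < length ?c"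
    using M1 Mi[of 2] Mi[of 3] g nth[of 1] nth[of 2] nth[of 3] by auto
  then have 1: "\<not> unimodal ?c" by (intro not_unimodal_if_valley[of 1 2 3]) auto
  \<comment> \<open>The same matroid serves again: a nonnegative entry below both neighbours
    violates log-concavity.\<close>
  have "(?c ! 2)\<^sup>2 < ?c ! 1 * ?c ! 3"
    unfolding power2_eq_square using valley by (intro mult_strict_mono) auto
  then have 2: "\<not> log_concave_seq ?c"
    using valley by (auto simp: log_concave_seq_def intro!: exI[of _ 2] simp: numeral_eq_Suc)
  \<comment> \<open>For \<open>k = 3\<close> the polynomial is a monic cubic with quadratic
    coefficient \<open>?s\<close>, and \<open>?s\<^sup>2 + 1\<close> axes push the linear
    coefficient beyond the square of \<open>?s\<close>.\<close>
  let ?s = "gauss_binomial ?q 3 2"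
  obtain M' :: "nat pre_matroid" where M': "matroid M'" "loopless M'"
    and M'1: "int (?s\<^sup>2 + 1) \<le> coeff (kl_poly M') 1"
    and M'i: "\<And>i. 2 \<le> i \<Longrightarrow> coeff (kl_poly M') i = int (gauss_binomial ?q 3 i)"
    by (rule exists_matroid_kl_coeffs[where 'f = 'f and k = 3 and N = "?s\<^sup>2 + 1"]) (rule that)
  have "coeff (kl_poly M') 3 = 1" using M'i[of 3] by (simp add: gauss_binomial_self)
  moreover have "degree (kl_poly M') = 3"
  proof (rule antisym)
    show "degree (kl_poly M') \<le> 3" by (rule degree_le) (simp add: M'i gauss_binomial_eq_0)
    show "3 \<le> degree (kl_poly M')" by (rule le_degree) (simp add: calculation)
  qed
  moreover have "(coeff (kl_poly M') 2)\<^sup>2 < 2 * coeff (kl_poly M') 1"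
    using M'1 zero_le_power2[of "int ?s"] unfolding M'i[OF order_refl] of_nat_add of_nat_power by linarith
  ultimately have 3: "\<not> all_zeros_real (kl_poly M')" by (intro not_all_zeros_real_cubic)
  show ?thesis using M M' 1 2 3 by blast
qed

end
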